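(* Let $\eta=(\eta_0,\check\eta)$ be the fixed root of the Lopatinskii determinant $\Delta$ and let $$\alpha_0:=\sigma^*\,[\tilde f^0]+i\sum_{p=1}^{d+1}\sum_{q=1}^{d+1}\sigma^*H R_p^+\,\frac{(L_p^+)^*\,\gamma_q R_q^-}{\beta_p^+-\beta_q^-},\qquad [\tilde f^0]:=\tilde f^0(v_r)-\tilde f^0(v_\ell),$$ all quantities being evaluated at this root. Then $$\alpha_0=-\frac{[\rho]\,[u]\,\Upsilon}{\eta_0}\,(\eta_0^2+u_r^2|\check\eta|^2)\left\{u_\ell^2u_r^2\left(\frac{a_\ell^2}{c_\ell^2}+\frac{a_r^2}{c_r^2}\right)+2\,c_\ell^2c_r^2\,\eta_0^2\right\},$$ and $\alpha_0$ coincides with the partial derivative $\partial_{\eta_0}\Delta$ of the Lopatinskii determinant with respect to $\eta_0$ at the root $\eta$. In particular, $\alpha_0$ is a nonzero real number.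
   Context: **Fluid model.** Let $d\ge 2$, let $p=p(\rho)$ be a smooth pressure law, $f$ the specific free energy with $p=\rho^2 f'$, and $g:=f+p/\rho$ (so $\rho g'=p'$). For $v=(\rho,\check\jmath,j_d)$ with $\rho>0$, $\check\jmath=(j_1,\dots,j_{d-1})\in\mathbb R^{d-1}$, $j=(\check\jmath,j_d)$, put $f^0(v)=v$; $f^k(v)=(j_k,\ j_k\check\jmath/\rho+p(\rho)e_k,\ j_kj_d/\rho)$ for $1\le k\le d-1$ ($e_k$ the canonical basis of $\mathbb R^{d-1}$); $f^d(v)=(j_d,\ j_d\check\jmath/\rho,\ j_d^2/\rho+p(\rho))$; $g^0(v)=|j|^2/(2\rho)+\rho f(\rho)$; $g^k(v)=\big(|j|^2/(2\rho^2)+g(\rho)\big)j_k$ for $1\le k\le d$. Set $\tilde f^k=(f^k,g^k)\in\mathbb R^{d+2}$ and $A^k(v)=\mathrm d f^k(v)$ ($A^0=I$). **Reference phase boundary.** $v_\ell=(\rho_\ell,0,\rho_\ell u_\ell)$, $v_r=(\rho_r,0,\rho_r u_r)$ with $\rho_\ell\ne\rho_r$, $\rho_\ell u_\ell=\rho_ru_r$, $\rho_\ell u_\ell^2+p(\rho_\ell)=\rho_ru_r^2+p(\rho_r)$ and $\mu:=\frac12u_\ell^2+g(\rho_\ell)=\frac12u_r^2+g(\rho_r)$. With $c_{\ell,r}:=\sqrt{p'(\rho_{\ell,r})}>0$ one assumes $0<u_\ell<c_\ell$, $0<u_r<c_r$. Jumps: $[X]=X_r-X_\ell$. **Modes.**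 Frequencies are $\eta=(\eta_0,\check\eta)\in\mathbb R\times\mathbb R^{d-1}$ with $\eta_0\neq0$, $\check\eta\ne0$ and $(c_{\ell}^2-u_{\ell}^2)|\check\eta|^2>\eta_0^2$, $(c_r^2-u_r^2)|\check\eta|^2>\eta_0^2$. Put $a_\ell=-c_\ell\sqrt{(c_\ell^2-u_\ell^2)|\check\eta|^2-\eta_0^2}$, $a_r=c_r\sqrt{(c_r^2-u_r^2)|\check\eta|^2-\eta_0^2}$, $$\beta_1^-=\frac{a_\ell-iu_\ell\eta_0}{c_\ell^2-u_\ell^2},\quad \beta_1^+=-\overline{\beta_1^-},\quad \beta_2^-=\frac{-a_r+iu_r\eta_0}{c_r^2-u_r^2},\quad\beta_2^+=-\overline{\beta_2^-},$$ $\beta_j^+=i\eta_0/u_\ell$, $\beta_j^-=-i\eta_0/u_r$ for $3\le j\le d+1$. Let $\check e_1=\check\eta$ and let $\check e_2,\dots,\check e_{d-1}$ be a basis of $\check\eta^\perp\subset\mathbb R^{d-1}$, with dual basis $\check e_2',\dots,\check e_{d-1}'$ in $\check\eta^\perp$ (these do not vary when $\eta_0$ varies). Right eigenvectors: $R_1^\pm=\binom{r_1^\pm}{0}$, $R_2^\pm=\binom{0}{r_2^\pm}$, $R_j^+=\binom{r_j^+}{0}$, $R_j^-=\binom{0}{r_j^-}$ ($j\ge3$) in $\mathbb C^{2(d+1)}$, where $$r_1^-=\begin{pmatrix}-i\eta_0+u_\ell\beta_1^-\\ ic_\ell^2\check\eta\\-a_\ell\end{pmatrix},\ r_1^+=\overline{r_1^-},\quad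 r_2^-=\begin{pmatrix}-i\eta_0-u_r\beta_2^-\\ ic_r^2\check\eta\\-a_r\end{pmatrix},\ r_2^+=\overline{r_2^-},$$ $$r_j^+=\begin{pmatrix}0\\ \eta_0\check e_{j-2}\\ u_\ell\,\check\eta\cdot\check e_{j-2}\end{pmatrix},\quad r_j^-=\begin{pmatrix}0\\ \eta_0\check e_{j-2}\\ u_r\,\check\eta\cdot\check e_{j-2}\end{pmatrix}\quad(3\le j\le d+1).$$ Left eigenvectors: $L_1^+=\binom{\ell_1^+}{0}$, $L_2^+=\binom{0}{\ell_2^+}$, $L_j^+=\binom{\ell_j^+}{0}$ ($j\ge3$), where $$\ell_1^+=\frac{c_\ell^2-u_\ell^2}{2a_\ell(u_\ell a_\ell-ic_\ell^2\eta_0)}\begin{pmatrix}-i\eta_0+2u_\ell\beta_1^-\\ i\check\eta\\-\beta_1^-\end{pmatrix},\quad \ell_2^+=\frac{c_r^2-u_r^2}{2a_r(u_ra_r-ic_r^2\eta_0)}\begin{pmatrix}i\eta_0+2u_r\beta_2^-\\-i\check\eta\\-\beta_2^-\end{pmatrix},$$ $$\ell_3^+=\frac1{\eta_0^2+u_\ell^2|\check\eta|^2}\begin{pmatrix}u_\ell\\-\frac{\eta_0}{u_\ell|\check\eta|^2}\check\eta\\-1\end{pmatrix},\quad \ell_j^+=-\frac1{u_\ell\eta_0}\begin{pmatrix}0\\\check e_{j-2}'\\0\end{pmatrix}\ (4\le j\le d+1).$$ **Lopatinskii determinant.** Let $H=\big(\mathrm d\tilde f^d(v_\ell)\ \ -\mathrm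 d\tilde f^d(v_r)\big)$, a $(d+2)\times2(d+1)$ matrix, explicitly $$H=\begin{pmatrix}0&0&1&0&0&-1\\0&u_\ell I_{d-1}&0&0&-u_rI_{d-1}&0\\c_\ell^2-u_\ell^2&0&2u_\ell&-(c_r^2-u_r^2)&0&-2u_r\\(c_\ell^2-u_\ell^2)u_\ell&0&u_\ell^2+\mu&-(c_r^2-u_r^2)u_r&0&-u_r^2-\mu\end{pmatrix},$$ $J\eta=\sum_{j=0}^{d-1}\eta_j[\tilde f^j]=\big([\rho]\eta_0,\ [p]\check\eta,\ 0,\ (\mu[\rho]-[p])\eta_0\big)^T$ with $\check\eta=(\eta_1,\dots,\eta_{d-1})$, and $\Delta(\eta)=\det\big(J\eta\ \ HR_1^-\ \cdots\ HR_{d+1}^-\big)$. Put $\Upsilon=(-u_r\eta_0)^{d-2}u_r\det(\check e_1\cdots\check e_{d-1})\in\mathbb R\setminus\{0\}$. Fix a root $\eta=(\eta_0,\check\eta)\in\mathbb R\times\mathbb R^{d-1}$ of $\Delta$ with $\eta_0\neq0$, $\check\eta\ne0$, $(c_\ell^2-u_\ell^2)|\check\eta|^2>\eta_0^2$ and $(c_r^2-u_r^2)|\check\eta|^2>\eta_0^2$; equivalently $u_\ell u_ra_\ell a_r+c_\ell^2c_r^2\eta_0^2=0$. At this root: $\sigma\in\mathbb C^{d+2}$ is the vector such that $\det\big(X\ \ HR_1^-\ \cdots\ HR_{d+1}^-\big)=\sigma^*X$ for all $X\in\mathbb C^{d+2}$ (${}^*$ = conjugate transpose); and $$\gamma_1=\frac{[\rho]u_r\eta_0}{u_ra_\ell-ic_\ell^2\eta_0},\quad\gamma_2=\frac{-[\rho]u_\ell\eta_0}{u_\ell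 a_r-ic_r^2\eta_0},\quad\gamma_3=\dots=\gamma_{d+1}=0,$$ which satisfy $J\eta+\gamma_1HR_1^-+\gamma_2HR_2^-=0$. *)

theory Defs
  imports
    "HOL-Analysis.Derivative"
    "Jordan_Normal_Form.VS_Connect"
begin

unbundle no vec_syntax
no_notation inner (infix "\<bullet>" 70)

text \<open>
  All vectors and matrices are those of \<open>Jordan_Normal_Form\<close>, whose indices start at 0, so that the
  space dimension \<open>d\<close> is an ordinary natural number.  A fluid state is a real vector \<open>v\<close> of dimension
  \<open>d + 1\<close>: entry 0 is the density and entry \<open>k\<close>, for \<open>1 \<le> k \<le> d\<close>, is the momentum component \<open>j\<^sub>k\<close>.
\<close>

definition stack :: "'a \<Rightarrow> 'a vec \<Rightarrow> 'a \<Rightarrow> 'a vec" where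
  "stack x y z = vec (dim_vec y + 2)
     (\<lambda>i. if i = 0 then x else if i \<le> dim_vec y then y $ (i - 1) else z)"

abbreviation cvec :: "real vec \<Rightarrow> complex vec" where
  "cvec \<equiv> map_vec complex_of_real"

abbreviation cmat :: "real mat \<Rightarrow> complex mat" where
  "cmat \<equiv> map_mat complex_of_real"

definition smooth_law :: "(real \<Rightarrow> real) \<Rightarrow> bool" where
  "smooth_law p \<longleftrightarrow> (\<forall>n. \<forall>\<rho>>0. ((deriv ^^ n) p) field_differentiable (at \<rho>))"

definition specific_free_energy :: "(real \<Rightarrow> real) \<Rightarrow> (real \<Rightarrow> real) \<Rightarrow> bool" where
  "specific_free_energy p f \<longleftrightarrow>
     (\<forall>\<rho>>0. f field_differentiable (at \<rho>) \<and> p \<rho> = \<rho>\<^sup>2 * deriv f \<rho>)"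

definition gibbs :: "(real \<Rightarrow> real) \<Rightarrow> (real \<Rightarrow> real) \<Rightarrow> real \<Rightarrow> real" where
  "gibbs p f \<rho> = f \<rho> + p \<rho> / \<rho>"

definition momentum_sq :: "nat \<Rightarrow> real vec \<Rightarrow> real" where
  "momentum_sq d v = (\<Sum>k=1..d. (v $ k)\<^sup>2)"

text \<open>The single formula for \<open>1 \<le> k \<le> d\<close> covers \<open>f\<^sup>1, \<dots>, f\<^sup>d\<close>, since \<open>j\<^sub>d\<close> is just entry \<open>d\<close> of the state.\<close>

definition flux :: "nat \<Rightarrow> (real \<Rightarrow> real) \<Rightarrow> nat \<Rightarrow> real vec \<Rightarrow> real vec" where
  "flux d p k v =
     (if k = 0 then v
      else vec (d + 1) (\<lambda>i. if i = 0 then v $ k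
                            else v $ k * v $ i / v $ 0 + (if i = k then p (v $ 0) else 0)))"

definition energy_flux :: "nat \<Rightarrow> (real \<Rightarrow> real) \<Rightarrow> (real \<Rightarrow> real) \<Rightarrow> nat \<Rightarrow> real vec \<Rightarrow> real" where
  "energy_flux d p f k v =
     (if k = 0 then momentum_sq d v / (2 * v $ 0) + v $ 0 * f (v $ 0)
      else (momentum_sq d v / (2 * (v $ 0)\<^sup>2) + gibbs p f (v $ 0)) * v $ k)"

definition full_flux :: "nat \<Rightarrow> (real \<Rightarrow> real) \<Rightarrow> (real \<Rightarrow> real) \<Rightarrow> nat \<Rightarrow> real vec \<Rightarrow> real vec" where
  "full_flux d p f k v = flux d p k v @\<^sub>v vec 1 (\<lambda>_. energy_flux d p f k v)"

definition jacobian :: "nat \<Rightarrow> nat \<Rightarrow> (real vec \<Rightarrow> real vec) \<Rightarrow> real vec \<Rightarrow> real mat" where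
  "jacobian m n F v = mat m n (\<lambda>(i, k). deriv (\<lambda>s. F (v + s \<cdot>\<^sub>v unit_vec n k) $ i) 0)"

record phase_boundary =
  dm :: nat
  pressure :: "real \<Rightarrow> real"
  free_energy :: "real \<Rightarrow> real"
  rho_l :: real
  rho_r :: real
  u_l :: real
  u_r :: real

definition c_l :: "phase_boundary \<Rightarrow> real" where
  "c_l B = sqrt (deriv (pressure B) (rho_l B))"

definition c_r :: "phase_boundary \<Rightarrow> real" where
  "c_r B = sqrt (deriv (pressure B) (rho_r B))"

definition v_l :: "phase_boundary \<Rightarrow> real vec" where
  "v_l B = stack (rho_l B) (0\<^sub>v (dm B - 1)) (rho_l B * u_l B)"

definition v_r :: "phase_boundary \<Rightarrow> real vec" where
  "v_r B = stack (rho_r B) (0\<^sub>v (dm B - 1)) (rho_r B * u_r B)"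

definition reference_phase_boundary :: "phase_boundary \<Rightarrow> bool" where
  "reference_phase_boundary B \<longleftrightarrow>
     2 \<le> dm B \<and>
     smooth_law (pressure B) \<and>
     specific_free_energy (pressure B) (free_energy B) \<and>
     0 < rho_l B \<and> 0 < rho_r B \<and> rho_l B \<noteq> rho_r B \<and>
     rho_l B * u_l B = rho_r B * u_r B \<and>
     rho_l B * (u_l B)\<^sup>2 + pressure B (rho_l B) = rho_r B * (u_r B)\<^sup>2 + pressure B (rho_r B) \<and>
     (u_l B)\<^sup>2 / 2 + gibbs (pressure B) (free_energy B) (rho_l B)
       = (u_r B)\<^sup>2 / 2 + gibbs (pressure B) (free_energy B) (rho_r B) \<and>
     0 < deriv (pressure B) (rho_l B) \<and> 0 < deriv (pressure B) (rho_r B) \<and>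
     0 < u_l B \<and> u_l B < c_l B \<and>
     0 < u_r B \<and> u_r B < c_r B"

definition jump_flux :: "phase_boundary \<Rightarrow> nat \<Rightarrow> real vec" where
  "jump_flux B k =
     full_flux (dm B) (pressure B) (free_energy B) k (v_r B)
       - full_flux (dm B) (pressure B) (free_energy B) k (v_l B)"

definition H_mat :: "phase_boundary \<Rightarrow> real mat" where
  "H_mat B =
     (let d = dm B;
          A = jacobian (d + 2) (d + 1) (full_flux d (pressure B) (free_energy B) d)
      in mat (d + 2) (2 * (d + 1))
           (\<lambda>(i, k). if k < d + 1 then A (v_l B) $$ (i, k) else - (A (v_r B) $$ (i, k - (d + 1)))))"

definition J_eta :: "phase_boundary \<Rightarrow> real \<Rightarrow> real vec \<Rightarrow> real vec" where
  "J_eta B \<eta>\<^sub>0 \<eta> = vec (dm B + 2)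
     (\<lambda>i. \<Sum>j<dm B. (if j = 0 then \<eta>\<^sub>0 else \<eta> $ (j - 1)) * jump_flux B j $ i)"

text \<open>A frequency is a pair \<open>\<eta>\<^sub>0 :: real\<close> and \<open>\<eta> :: real vec\<close>, the latter of dimension \<open>d - 1\<close>.\<close>

definition elliptic_frequency :: "phase_boundary \<Rightarrow> real \<Rightarrow> real vec \<Rightarrow> bool" where
  "elliptic_frequency B \<eta>\<^sub>0 \<eta> \<longleftrightarrow>
     \<eta>\<^sub>0 \<noteq> 0 \<and> \<eta> \<in> carrier_vec (dm B - 1) \<and> \<eta> \<noteq> 0\<^sub>v (dm B - 1) \<and>
     ((c_l B)\<^sup>2 - (u_l B)\<^sup>2) * (\<eta> \<bullet> \<eta>) > \<eta>\<^sub>0\<^sup>2 \<and>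
     ((c_r B)\<^sup>2 - (u_r B)\<^sup>2) * (\<eta> \<bullet> \<eta>) > \<eta>\<^sub>0\<^sup>2"

definition a_l :: "phase_boundary \<Rightarrow> real \<Rightarrow> real vec \<Rightarrow> real" where
  "a_l B \<eta>\<^sub>0 \<eta> = - c_l B * sqrt (((c_l B)\<^sup>2 - (u_l B)\<^sup>2) * (\<eta> \<bullet> \<eta>) - \<eta>\<^sub>0\<^sup>2)"

definition a_r :: "phase_boundary \<Rightarrow> real \<Rightarrow> real vec \<Rightarrow> real" where
  "a_r B \<eta>\<^sub>0 \<eta> = c_r B * sqrt (((c_r B)\<^sup>2 - (u_r B)\<^sup>2) * (\<eta> \<bullet> \<eta>) - \<eta>\<^sub>0\<^sup>2)"

definition beta_minus :: "phase_boundary \<Rightarrow> real \<Rightarrow> real vec \<Rightarrow> nat \<Rightarrow> complex" where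
  "beta_minus B \<eta>\<^sub>0 \<eta> j =
     (if j = 1 then (a_l B \<eta>\<^sub>0 \<eta> - \<i> * u_l B * \<eta>\<^sub>0) / ((c_l B)\<^sup>2 - (u_l B)\<^sup>2)
      else if j = 2 then (- a_r B \<eta>\<^sub>0 \<eta> + \<i> * u_r B * \<eta>\<^sub>0) / ((c_r B)\<^sup>2 - (u_r B)\<^sup>2)
      else - \<i> * \<eta>\<^sub>0 / u_r B)"

definition beta_plus :: "phase_boundary \<Rightarrow> real \<Rightarrow> real vec \<Rightarrow> nat \<Rightarrow> complex" where
  "beta_plus B \<eta>\<^sub>0 \<eta> j =
     (if j = 1 \<or> j = 2 then - cnj (beta_minus B \<eta>\<^sub>0 \<eta> j) else \<i> * \<eta>\<^sub>0 / u_l B)"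

text \<open>
  The family \<open>e\<close> is indexed by \<open>1, \<dots>, d - 1\<close>, with \<open>e 1 = \<eta>\<close>; \<open>e 2, \<dots>, e (d - 1)\<close> is a basis of the
  orthogonal complement of \<open>\<eta>\<close>, and \<open>e' 2, \<dots>, e' (d - 1)\<close> the dual basis in that same space.
\<close>

definition orth_compl :: "nat \<Rightarrow> real vec \<Rightarrow> real vec set" where
  "orth_compl n \<eta> = {x \<in> carrier_vec n. x \<bullet> \<eta> = 0}"

definition transverse_bases ::
    "phase_boundary \<Rightarrow> real vec \<Rightarrow> (nat \<Rightarrow> real vec) \<Rightarrow> (nat \<Rightarrow> real vec) \<Rightarrow> bool" where
  "transverse_bases B \<eta> e e' \<longleftrightarrow>
     (let n = dm B - 1; W = orth_compl n \<eta> in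
        e 1 = \<eta> \<and>
        inj_on e {2..n} \<and>
        vectorspace.basis class_ring (module_vec TYPE(real) n\<lparr>carrier := W\<rparr>) (e ` {2..n}) \<and>
        (\<forall>k\<in>{2..n}. e' k \<in> W) \<and>
        (\<forall>k\<in>{2..n}. \<forall>l\<in>{2..n}. e' k \<bullet> e l = (if k = l then 1 else 0)))"

definition r1_minus :: "phase_boundary \<Rightarrow> real \<Rightarrow> real vec \<Rightarrow> complex vec" where
  "r1_minus B \<eta>\<^sub>0 \<eta> =
     stack (- \<i> * \<eta>\<^sub>0 + u_l B * beta_minus B \<eta>\<^sub>0 \<eta> 1)
           ((\<i> * (c_l B)\<^sup>2) \<cdot>\<^sub>v cvec \<eta>)
           (- a_l B \<eta>\<^sub>0 \<eta>)"

definition r2_minus :: "phase_boundary \<Rightarrow> real \<Rightarrow> real vec \<Rightarrow> complex vec" where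
  "r2_minus B \<eta>\<^sub>0 \<eta> =
     stack (- \<i> * \<eta>\<^sub>0 - u_r B * beta_minus B \<eta>\<^sub>0 \<eta> 2)
           ((\<i> * (c_r B)\<^sup>2) \<cdot>\<^sub>v cvec \<eta>)
           (- a_r B \<eta>\<^sub>0 \<eta>)"

definition rj_plus :: "phase_boundary \<Rightarrow> (nat \<Rightarrow> real vec) \<Rightarrow> real \<Rightarrow> real vec \<Rightarrow> nat \<Rightarrow> complex vec" where
  "rj_plus B e \<eta>\<^sub>0 \<eta> j = cvec (stack 0 (\<eta>\<^sub>0 \<cdot>\<^sub>v e (j - 2)) (u_l B * (\<eta> \<bullet> e (j - 2))))"

definition rj_minus :: "phase_boundary \<Rightarrow> (nat \<Rightarrow> real vec) \<Rightarrow> real \<Rightarrow> real vec \<Rightarrow> nat \<Rightarrow> complex vec" where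
  "rj_minus B e \<eta>\<^sub>0 \<eta> j = cvec (stack 0 (\<eta>\<^sub>0 \<cdot>\<^sub>v e (j - 2)) (u_r B * (\<eta> \<bullet> e (j - 2))))"

definition on_left :: "phase_boundary \<Rightarrow> complex vec \<Rightarrow> complex vec" where
  "on_left B x = x @\<^sub>v 0\<^sub>v (dm B + 1)"

definition on_right :: "phase_boundary \<Rightarrow> complex vec \<Rightarrow> complex vec" where
  "on_right B x = 0\<^sub>v (dm B + 1) @\<^sub>v x"

definition R_minus :: "phase_boundary \<Rightarrow> (nat \<Rightarrow> real vec) \<Rightarrow> real \<Rightarrow> real vec \<Rightarrow> nat \<Rightarrow> complex vec" where
  "R_minus B e \<eta>\<^sub>0 \<eta> j =
     (if j = 1 then on_left B (r1_minus B \<eta>\<^sub>0 \<eta>)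
      else if j = 2 then on_right B (r2_minus B \<eta>\<^sub>0 \<eta>)
      else on_right B (rj_minus B e \<eta>\<^sub>0 \<eta> j))"

definition R_plus :: "phase_boundary \<Rightarrow> (nat \<Rightarrow> real vec) \<Rightarrow> real \<Rightarrow> real vec \<Rightarrow> nat \<Rightarrow> complex vec" where
  "R_plus B e \<eta>\<^sub>0 \<eta> j =
     (if j = 1 then on_left B (conjugate (r1_minus B \<eta>\<^sub>0 \<eta>))
      else if j = 2 then on_right B (conjugate (r2_minus B \<eta>\<^sub>0 \<eta>))
      else on_left B (rj_plus B e \<eta>\<^sub>0 \<eta> j))"

definition l1_plus :: "phase_boundary \<Rightarrow> real \<Rightarrow> real vec \<Rightarrow> complex vec" where
  "l1_plus B \<eta>\<^sub>0 \<eta> =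
     (((c_l B)\<^sup>2 - (u_l B)\<^sup>2)
        / (2 * a_l B \<eta>\<^sub>0 \<eta> * (u_l B * a_l B \<eta>\<^sub>0 \<eta> - \<i> * (c_l B)\<^sup>2 * \<eta>\<^sub>0))) \<cdot>\<^sub>v
     stack (- \<i> * \<eta>\<^sub>0 + 2 * u_l B * beta_minus B \<eta>\<^sub>0 \<eta> 1) (\<i> \<cdot>\<^sub>v cvec \<eta>) (- beta_minus B \<eta>\<^sub>0 \<eta> 1)"

definition l2_plus :: "phase_boundary \<Rightarrow> real \<Rightarrow> real vec \<Rightarrow> complex vec" where
  "l2_plus B \<eta>\<^sub>0 \<eta> =
     (((c_r B)\<^sup>2 - (u_r B)\<^sup>2)
        / (2 * a_r B \<eta>\<^sub>0 \<eta> * (u_r B * a_r B \<eta>\<^sub>0 \<eta> - \<i> * (c_r B)\<^sup>2 * \<eta>\<^sub>0))) \<cdot>\<^sub>v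
     stack (\<i> * \<eta>\<^sub>0 + 2 * u_r B * beta_minus B \<eta>\<^sub>0 \<eta> 2) ((- \<i>) \<cdot>\<^sub>v cvec \<eta>) (- beta_minus B \<eta>\<^sub>0 \<eta> 2)"

definition l3_plus :: "phase_boundary \<Rightarrow> real \<Rightarrow> real vec \<Rightarrow> complex vec" where
  "l3_plus B \<eta>\<^sub>0 \<eta> =
     cvec ((1 / (\<eta>\<^sub>0\<^sup>2 + (u_l B)\<^sup>2 * (\<eta> \<bullet> \<eta>))) \<cdot>\<^sub>v
             stack (u_l B) ((- (\<eta>\<^sub>0 / (u_l B * (\<eta> \<bullet> \<eta>)))) \<cdot>\<^sub>v \<eta>) (- 1))"

definition lj_plus :: "phase_boundary \<Rightarrow> (nat \<Rightarrow> real vec) \<Rightarrow> real \<Rightarrow> nat \<Rightarrow> complex vec" where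
  "lj_plus B e' \<eta>\<^sub>0 j = cvec ((- 1 / (u_l B * \<eta>\<^sub>0)) \<cdot>\<^sub>v stack 0 (e' (j - 2)) 0)"

definition L_plus :: "phase_boundary \<Rightarrow> (nat \<Rightarrow> real vec) \<Rightarrow> real \<Rightarrow> real vec \<Rightarrow> nat \<Rightarrow> complex vec" where
  "L_plus B e' \<eta>\<^sub>0 \<eta> j =
     (if j = 1 then on_left B (l1_plus B \<eta>\<^sub>0 \<eta>)
      else if j = 2 then on_right B (l2_plus B \<eta>\<^sub>0 \<eta>)
      else if j = 3 then on_left B (l3_plus B \<eta>\<^sub>0 \<eta>)
      else on_left B (lj_plus B e' \<eta>\<^sub>0 j))"

definition lopatinskii_det ::
    "phase_boundary \<Rightarrow> (nat \<Rightarrow> real vec) \<Rightarrow> real \<Rightarrow> real vec \<Rightarrow> complex vec \<Rightarrow> complex" where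
  "lopatinskii_det B e \<eta>\<^sub>0 \<eta> X =
     det (mat_of_cols (dm B + 2)
            (X # map (\<lambda>j. cmat (H_mat B) *\<^sub>v R_minus B e \<eta>\<^sub>0 \<eta> j) [1..<dm B + 2]))"

definition Delta :: "phase_boundary \<Rightarrow> (nat \<Rightarrow> real vec) \<Rightarrow> real \<Rightarrow> real vec \<Rightarrow> complex" where
  "Delta B e \<eta>\<^sub>0 \<eta> = lopatinskii_det B e \<eta>\<^sub>0 \<eta> (cvec (J_eta B \<eta>\<^sub>0 \<eta>))"

definition Upsilon :: "phase_boundary \<Rightarrow> (nat \<Rightarrow> real vec) \<Rightarrow> real \<Rightarrow> real" where
  "Upsilon B e \<eta>\<^sub>0 =
     (- u_r B * \<eta>\<^sub>0) ^ (dm B - 2) * u_r B * det (mat_of_cols (dm B - 1) (map e [1..<dm B]))"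

text \<open>The product \<open>\<sigma>\<^sup>* X\<close> with the conjugate transpose is \<open>conjugate \<sigma> \<bullet> X\<close>, as the scalar product
  \<open>\<bullet>\<close> does not conjugate.\<close>

definition is_sigma ::
    "phase_boundary \<Rightarrow> (nat \<Rightarrow> real vec) \<Rightarrow> real \<Rightarrow> real vec \<Rightarrow> complex vec \<Rightarrow> bool" where
  "is_sigma B e \<eta>\<^sub>0 \<eta> \<sigma> \<longleftrightarrow>
     \<sigma> \<in> carrier_vec (dm B + 2) \<and>
     (\<forall>X\<in>carrier_vec (dm B + 2). lopatinskii_det B e \<eta>\<^sub>0 \<eta> X = conjugate \<sigma> \<bullet> X)"

definition gamma :: "phase_boundary \<Rightarrow> real \<Rightarrow> real vec \<Rightarrow> nat \<Rightarrow> complex" where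
  "gamma B \<eta>\<^sub>0 \<eta> j =
     (if j = 1 then (rho_r B - rho_l B) * u_r B * \<eta>\<^sub>0 / (u_r B * a_l B \<eta>\<^sub>0 \<eta> - \<i> * (c_l B)\<^sup>2 * \<eta>\<^sub>0)
      else if j = 2 then - (rho_r B - rho_l B) * u_l B * \<eta>\<^sub>0 / (u_l B * a_r B \<eta>\<^sub>0 \<eta> - \<i> * (c_r B)\<^sup>2 * \<eta>\<^sub>0)
      else 0)"

definition alpha0 ::
    "phase_boundary \<Rightarrow> (nat \<Rightarrow> real vec) \<Rightarrow> (nat \<Rightarrow> real vec) \<Rightarrow> real \<Rightarrow> real vec \<Rightarrow> complex vec \<Rightarrow> complex"
  where
  "alpha0 B e e' \<eta>\<^sub>0 \<eta> \<sigma> =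
     conjugate \<sigma> \<bullet> cvec (jump_flux B 0)
     + \<i> * (\<Sum>p=1..dm B + 1. \<Sum>q=1..dm B + 1.
          (conjugate \<sigma> \<bullet> (cmat (H_mat B) *\<^sub>v R_plus B e \<eta>\<^sub>0 \<eta> p))
          * (conjugate (L_plus B e' \<eta>\<^sub>0 \<eta> p) \<bullet> (gamma B \<eta>\<^sub>0 \<eta> q \<cdot>\<^sub>v R_minus B e \<eta>\<^sub>0 \<eta> q))
          / (beta_plus B \<eta>\<^sub>0 \<eta> p - beta_minus B \<eta>\<^sub>0 \<eta> q))"

end

theory Submission
  imports Defs
begin

text \<open>
  Write \<open>u, v\<close> for the two velocities, \<open>C, D\<close> for the squared sound speeds, \<open>a, b\<close> for \<open>a_l, a_r\<close>, \<open>t\<close> for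
  \<open>\<eta>\<^sub>0\<close>, \<open>N\<close> for \<open>\<bar>\<eta>\<bar>\<^sup>2\<close> and \<open>R\<close> for the density jump; then the pressure jump is \<open>u v R\<close>, by conservation of
  mass and momentum.

  The columns \<open>H R\<^sub>j\<^sup>-\<close> with \<open>j \<ge> 3\<close> depend linearly on \<open>e (j - 2)\<close>: their transverse block is
  \<open>- v t e (j - 2)\<close> and their other three entries are multiples of \<open>\<eta> \<bullet> e (j - 2)\<close>.  Row operations
  therefore clear these three entries and leave \<open>- t Upsilon\<close> times a 3 by 3 determinant.  On vectors
  whose transverse block is a multiple of \<open>\<eta>\<close>, such as \<open>J \<eta>\<close>, \<open>H R\<^sub>1\<^sup>\<plusminus>\<close>, \<open>H R\<^sub>2\<^sup>\<plusminus>\<close>, \<open>H R\<^sub>3\<^sup>+\<close> and the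
  time jump, \<open>\<sigma>\<^sup>* X\<close> is thus \<open>- Upsilon\<close> times an explicit linear functional
  (\<open>lopatinskii_det_eq\<close>).  Its value at \<open>J \<eta>\<close> gives, for all \<open>t \<noteq> 0\<close> (\<open>Delta_eq\<close>),

    \<open>\<Delta> = - Upsilon (t\<^sup>2 + v\<^sup>2 N) R (v - u) F\<close> with \<open>F = u v a b + C D t\<^sup>2\<close>.

  The prefactor does not vanish; for the factor \<open>Upsilon\<close> this holds because the dual basis shows that
  \<open>det (e 1, \<dots>, e (d - 1)) \<noteq> 0\<close>.  So the roots of \<open>\<Delta>\<close> are those of \<open>F\<close>, and at a root the derivative of \<open>\<Delta>\<close> is the prefactor times \<open>F'\<close>.  Since
  \<open>a a' = - C t\<close> and \<open>b b' = - D t\<close>, the equation \<open>F = 0\<close> turns \<open>t F'\<close> into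
  \<open>u\<^sup>2 v\<^sup>2 (a\<^sup>2 / C + b\<^sup>2 / D) + 2 C D t\<^sup>2\<close> (\<open>Delta_derivative\<close>), which is positive.

  It remains to evaluate \<open>\<alpha>\<^sub>0\<close>.  In the double sum \<open>\<gamma>\<^sub>q = 0\<close> for \<open>q \<ge> 3\<close>, and a left mode pairs to zero with
  a right mode that lives on the other side of the boundary; moreover the \<open>e' k\<close> are orthogonal to
  \<open>\<eta>\<close>.  Only the pairs \<open>(1,1)\<close>, \<open>(2,2)\<close> and \<open>(3,1)\<close> survive (\<open>L_R_zero\<close>).  The resulting four terms
  are rational functions of the parameters, and \<open>mode_sum_at_root\<close> adds them up.  Two facts make the
  denominators disappear: at a root the denominators of \<open>\<gamma>\<^sub>1\<close> and \<open>\<gamma>\<^sub>2\<close> are proportional to each other,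
  and \<open>\<bar>u a - \<i> C t\<bar>\<^sup>2 = C (C - u\<^sup>2) (t\<^sup>2 + u\<^sup>2 N)\<close>.  The sum is the same prefactor times \<open>F'\<close>.
\<close>

section \<open>Determinants with a transverse block\<close>

lemma det_3:
  fixes A :: "'a :: comm_ring_1 mat"
  assumes "A \<in> carrier_mat 3 3"
  shows "det A = A $$ (0,0) * (A $$ (1,1) * A $$ (2,2) - A $$ (1,2) * A $$ (2,1))
      - A $$ (1,0) * (A $$ (0,1) * A $$ (2,2) - A $$ (0,2) * A $$ (2,1))
      + A $$ (2,0) * (A $$ (0,1) * A $$ (1,2) - A $$ (0,2) * A $$ (1,1))"
proof -
  have d: "dim_row A = 3" "dim_col A = 3" using assms by auto
  have d2: "det M = M $$ (0,0) * M $$ (1,1) - M $$ (0,1) * M $$ (1,0)"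
    if M: "M \<in> carrier_mat 2 2" for M :: "'a mat"
    using laplace_expansion_column[OF M, of 0] M
    by (simp add: cofactor_def numeral_2_eq_2 lessThan_Suc mat_delete_dim det_single mat_delete_def algebra_simps)
  have c: "mat_delete A i 0 \<in> carrier_mat 2 2" for i
    using d by (auto simp: mat_delete_def)
  show ?thesis
    using laplace_expansion_column[OF assms, of 0] d
    by (simp add: cofactor_def numeral_3_eq_3 lessThan_Suc d2[OF c, unfolded numeral_2_eq_2])
      (simp add: mat_delete_def numeral_2_eq_2 algebra_simps)
qed

text \<open>
  Block elimination: the last \<open>n\<close> columns are determined by their middle block, because each of the
  rows 0, \<open>n + 1\<close>, \<open>n + 2\<close> of these columns is a fixed combination, with coefficients \<open>W r\<close>, of the
  middle rows.  Subtracting these combinations decouples the middle block from the remaining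
  determinant of size 3.
\<close>

lemma det_eliminate_block:
  fixes M :: "'a :: idom mat" and D :: "'a mat" and W :: "nat \<Rightarrow> nat \<Rightarrow> 'a"
  assumes M: "M \<in> carrier_mat (n + 3) (n + 3)" and D: "D \<in> carrier_mat n n"
    and block: "\<And>i k. i < n \<Longrightarrow> k < n \<Longrightarrow> M $$ (i + 1, k + 3) = D $$ (i, k)"
    and outer: "\<And>r k. r < 3 \<Longrightarrow> k < n \<Longrightarrow>
       M $$ (if r = 0 then 0 else n + r, k + 3) = (\<Sum>i<n. W r i * D $$ (i, k))"
  shows "det M = det D * det (mat 3 3 (\<lambda>(r, j). M $$ (if r = 0 then 0 else n + r, j) - (\<Sum>i<n. W r i * M $$ (i + 1, j))))"
proof -
  define A1 where "A1 = mat 3 3 (\<lambda>(r, j). M $$ (if r = 0 then 0 else n + r, j))"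
  define C1 where "C1 = mat n 3 (\<lambda>(i, j). M $$ (i + 1, j))"
  define Q where "Q = mat 3 n (\<lambda>(r, i). W r i)"
  define S where "S = A1 - Q * C1"
  have car: "A1 \<in> carrier_mat 3 3" "C1 \<in> carrier_mat n 3" "Q \<in> carrier_mat 3 n" "S \<in> carrier_mat 3 3"
    unfolding A1_def C1_def Q_def S_def by auto
  \<comment> \<open>Rows \<open>n + 1\<close> and \<open>n + 2\<close> move up past the \<open>n\<close> middle rows; the sign is \<open>(- 1) ^ (2 n) = 1\<close>.\<close>
  have "det M = (- 1) ^ (n * 2) *
    det (mat (n + 3) (n + 3) (\<lambda>(i, j). M $$ (if i < 1 then i else if i < 1 + 2 then i + n else i - 2, j)))"
    by (rule det_swap_final_rows[OF M]) simp
  also have "mat (n + 3) (n + 3) (\<lambda>(i, j). M $$ (if i < 1 then i else if i < 1 + 2 then i + n else i - 2, j))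
     = four_block_mat A1 (Q * D) C1 D" (is "?L = ?R")
  proof (rule eq_matI)
    show "dim_row ?L = dim_row ?R" "dim_col ?L = dim_col ?R" using car D by auto
    fix i j assume "i < dim_row ?R" "j < dim_col ?R"
    then have ij: "i < n + 3" "j < n + 3" using car D by auto
    have QD: "(Q * D) $$ (r, k) = (\<Sum>i<n. W r i * D $$ (i, k))" if "r < 3" "k < n" for r k
      using that D unfolding Q_def
      by (auto simp: scalar_prod_def lessThan_atLeast0 intro!: sum.cong)
    show "?L $$ (i, j) = ?R $$ (i, j)"
    proof (cases "i < 3")
      case True
      then have row: "(if i < 1 then i else if i < 1 + 2 then i + n else i - 2) = (if i = 0 then 0 else n + i)"
        by auto
      show ?thesis
      proof (cases "j < 3")
        case True
        with \<open>i < 3\<close> ij car D show ?thesis by (auto simp: row A1_def add.commute)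
      next
        case False
        then show ?thesis using outer[OF True, of "j - 3"] QD[OF True, of "j - 3"] ij car D True
          by (auto simp: row add.commute[of i n])
      qed
    next
      case False
      then have row: "i - 2 = i - 3 + 1" by auto
      show ?thesis
        using block[of "i - 3" "j - 3"] False ij car D
        by (cases "j < 3") (auto simp: row C1_def)
    qed
  qed
  also have "four_block_mat A1 (Q * D) C1 D
     = four_block_mat (1\<^sub>m 3) Q (0\<^sub>m n 3) (1\<^sub>m n) * four_block_mat S (0\<^sub>m 3 n) C1 D"
  proof -
    have "S + Q * C1 = A1" unfolding S_def using car by (intro eq_matI) auto
    moreover have "1\<^sub>m 3 * S + Q * C1 = S + Q * C1" "1\<^sub>m 3 * 0\<^sub>m 3 n + Q * D = Q * D"
      "0\<^sub>m n 3 * S + 1\<^sub>m n * C1 = C1" "0\<^sub>m n 3 * 0\<^sub>m 3 n + 1\<^sub>m n * D = D" using car D by auto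
    ultimately show ?thesis
      by (subst mult_four_block_mat[of _ 3 3 _ n _ n _ _ 3 _ n]) (use car D in auto)
  qed
  also have "det \<dots> = det (four_block_mat (1\<^sub>m 3) Q (0\<^sub>m n 3) (1\<^sub>m n :: 'a mat)) * det (four_block_mat S (0\<^sub>m 3 n) C1 D)"
    by (rule det_mult[of _ "3 + n"]) (use car D in auto)
  also have "\<dots> = det S * det D"
    using det_four_block_mat_lower_left_zero[of "1\<^sub>m 3 :: 'a mat" 3 Q n] 
      det_four_block_mat_upper_right_zero[of S 3 _ n C1 D] car D by auto
  also have "S = mat 3 3 (\<lambda>(r, j). M $$ (if r = 0 then 0 else n + r, j) - (\<Sum>i<n. W r i * M $$ (i + 1, j)))"
    unfolding S_def A1_def Q_def C1_def
    by (rule eq_matI) (auto simp: scalar_prod_def lessThan_atLeast0 intro!: sum.cong)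
  finally show ?thesis by (simp add: mult.commute)
qed

section \<open>Stacked vectors\<close>

lemma index_stack [simp]:
  "stack x y z $ 0 = x"
  "\<lbrakk>1 \<le> i; i \<le> dim_vec y\<rbrakk> \<Longrightarrow> stack x y z $ i = y $ (i - 1)"
  "i = dim_vec y + 1 \<Longrightarrow> stack x y z $ i = z"
  "dim_vec (stack x y z) = dim_vec y + 2"
  by (auto simp: stack_def)

lemma conjugate_stack [simp]: "conjugate (stack x y z) = stack (conjugate x) (conjugate y) (conjugate z)"
  by (rule eq_vecI) (auto simp: stack_def)

lemma cvec_stack: "cvec (stack x y z) = stack (complex_of_real x) (cvec y) (complex_of_real z)"
  by (rule eq_vecI) (auto simp: stack_def)

lemma cvec_smult: "cvec (k \<cdot>\<^sub>v y) = complex_of_real k \<cdot>\<^sub>v cvec y"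
  by (rule eq_vecI) auto

lemma scalar_prod_stack:
  assumes "dim_vec y = dim_vec y'"
  shows "stack x y z \<bullet> stack x' y' z' = x * x' + y \<bullet> y' + z * (z' :: 'a :: comm_semiring_0)"
proof -
  have "stack x y z \<bullet> stack x' y' z' =
      (\<Sum>i=0..<Suc (Suc (dim_vec y')). stack x y z $ i * stack x' y' z' $ i)"
    by (simp add: scalar_prod_def)
  also have "\<dots> = x * x' + (\<Sum>i=0..<dim_vec y'. stack x y z $ Suc i * stack x' y' z' $ Suc i) + z * z'"
    unfolding sum.atLeast0_lessThan_Suc[of _ "Suc (dim_vec y')"] sum.atLeast0_lessThan_Suc_shift[of _ "dim_vec y'"]
    using assms by simp
  also have "(\<Sum>i=0..<dim_vec y'. stack x y z $ Suc i * stack x' y' z' $ Suc i) = y \<bullet> y'"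
    unfolding scalar_prod_def using assms by (intro sum.cong) auto
  finally show ?thesis .
qed

lemma cvec_scalar_prod: "dim_vec x = dim_vec y \<Longrightarrow> cvec x \<bullet> cvec y = complex_of_real (x \<bullet> y)"
  by (auto simp: scalar_prod_def intro!: sum.cong)

lemma conjugate_smult_cvec [simp]: "conjugate (k \<cdot>\<^sub>v cvec y) = cnj k \<cdot>\<^sub>v cvec y"
  by (rule eq_vecI) auto

lemma conjugate_append_vec: "conjugate (x @\<^sub>v y) = conjugate x @\<^sub>v conjugate y"
  by (rule eq_vecI) auto

lemma uminus_smult_vec: "- (k \<cdot>\<^sub>v y) = (- k) \<cdot>\<^sub>v (y :: 'a :: ring vec)"
  by (rule eq_vecI) auto

lemma smult_stack_minus:
  "k \<cdot>\<^sub>v stack x (c \<cdot>\<^sub>v y) z = (- k) \<cdot>\<^sub>v stack (- x) ((- c) \<cdot>\<^sub>v y) (- (z :: 'a :: ring))"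
  by (rule eq_vecI) (auto simp: stack_def)

text \<open>
  The value space of the full fluxes, of dimension \<open>d + 2\<close>: mass, transverse momentum, normal momentum
  and energy.
\<close>

definition balance :: "'a \<Rightarrow> 'a vec \<Rightarrow> 'a \<Rightarrow> 'a \<Rightarrow> 'a vec" where
  "balance x0 y x1 z = stack x0 y x1 @\<^sub>v vec 1 (\<lambda>_. z)"

lemma index_balance [simp]:
  "balance x0 y x1 z $ 0 = x0"
  "\<lbrakk>1 \<le> i; i \<le> dim_vec y\<rbrakk> \<Longrightarrow> balance x0 y x1 z $ i = y $ (i - 1)"
  "i = dim_vec y + 1 \<Longrightarrow> balance x0 y x1 z $ i = x1"
  "i = dim_vec y + 2 \<Longrightarrow> balance x0 y x1 z $ i = z"
  "dim_vec (balance x0 y x1 z) = dim_vec y + 3"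
  by (auto simp: balance_def)

lemma balance_eqI:
  assumes "dim_vec x = n + 3" "dim_vec y = n" "x $ 0 = x0"
    and "\<And>i. 1 \<le> i \<Longrightarrow> i \<le> n \<Longrightarrow> x $ i = y $ (i - 1)"
    and "x $ (n + 1) = x1" "x $ (n + 2) = z"
  shows "x = balance x0 y x1 z"
proof (rule eq_vecI)
  fix i assume "i < dim_vec (balance x0 y x1 z)"
  then consider "i = 0" | "1 \<le> i" "i \<le> n" | "i = n + 1" | "i = n + 2" using assms(2) by fastforce
  then show "x $ i = balance x0 y x1 z $ i"
    by cases (use assms in simp_all)
qed (use assms in simp)

lemma uminus_balance: "- balance x0 y x1 z = balance (- x0) (- y) (- x1) (- z :: 'a :: ring_1)"
proof (rule balance_eqI[of _ "dim_vec y"])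
  fix i assume "1 \<le> i" "i \<le> dim_vec y"
  moreover from this have "i < dim_vec y + 3" "i - 1 < dim_vec y" by auto
  ultimately show "(- balance x0 y x1 z) $ i = (- y) $ (i - 1)" by simp
qed auto

lemma balance_cong:
  "\<lbrakk>x0 = x0'; k = k'; x1 = x1'; z = z'\<rbrakk> \<Longrightarrow> balance x0 (k \<cdot>\<^sub>v y) x1 z = balance x0' (k' \<cdot>\<^sub>v y) x1' z'"
  by simp

section \<open>Algebra of the reduced Lopatinskii functional\<close>

text \<open>
  The value of \<open>\<sigma>\<^sup>* X / (- Upsilon)\<close> at the vector \<open>X\<close> with entries \<open>x0\<close>, \<open>y \<eta>\<close>, \<open>x1\<close>, \<open>z\<close>.  The numbers
  \<open>A\<close>, \<open>B\<close>, \<open>E\<close> are the minors of the two columns \<open>(- a, - u a - \<i> C t, - \<i> u C)\<close> and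
  \<open>(b, v b + \<i> D t, \<i> v D)\<close>, which come from \<open>H R\<^sub>1\<^sup>-\<close> and \<open>H R\<^sub>2\<^sup>-\<close>.  The quantity \<open>w\<close> vanishes at \<open>J \<eta>\<close>, at
  \<open>H R\<^sub>1\<^sup>\<plusminus>\<close> and at \<open>H R\<^sub>2\<^sup>\<plusminus>\<close>; there the functional is \<open>t\<^sup>2 + v\<^sup>2 N\<close> times the determinant of
  \<open>(x0, x1, - y)\<close> with these two columns.
\<close>

definition lopatinskii_functional :: "complex \<Rightarrow> complex \<Rightarrow> complex \<Rightarrow> complex \<Rightarrow> complex \<Rightarrow> complex \<Rightarrow> complex \<Rightarrow> complex \<Rightarrow> complex
   \<Rightarrow> complex \<Rightarrow> complex \<Rightarrow> complex \<Rightarrow> complex \<Rightarrow> complex" where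
  "lopatinskii_functional u v C D a b t N \<mu> x0 y x1 z =
     (let A = \<i> * u * v * (C * b - D * a) + (v - u) * C * D * t;
          B = \<i> * (u * C * b - v * D * a);
          E = (u - v) * a * b + \<i> * t * (C * b - D * a);
          w = z - \<mu> * x0 + t * y
      in (t\<^sup>2 + v\<^sup>2 * N) * (x0 * A - x1 * B - y * E) - w * (N * A - 2 * v * N * B - t * E))"

text \<open>
  The columns in the determinant are what \<open>X\<close>, \<open>H R\<^sub>1\<^sup>-\<close> and \<open>H R\<^sub>2\<^sup>-\<close> become after elimination of
  the transverse rows, where \<open>s = N / t\<close>.
\<close>

lemma lopatinskii_functional_as_det:
  fixes a b u v C D t s N \<mu> x0 y x1 z :: complex
  assumes "t * s = N"
  defines "p1 \<equiv> - a - \<i> * u * C * s" and "p2 \<equiv> - (u * a) - \<i> * C * t - 2 * v * (\<i> * u * C) * s"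
    and "p3 \<equiv> - (\<i> * u * C * t) - \<mu> * a - (v\<^sup>2 + \<mu>) * (\<i> * u * C) * s"
    and "q1 \<equiv> b - (- \<i> * v * D) * s" and "q2 \<equiv> v * b + \<i> * D * t - 2 * v * (- \<i> * v * D) * s"
    and "q3 \<equiv> \<i> * v * D * t + \<mu> * b - (v\<^sup>2 + \<mu>) * (- \<i> * v * D) * s"
  shows "t * ((x0 - y * s) * (p2 * q3 - q2 * p3) - (x1 - 2 * v * y * s) * (p1 * q3 - q1 * p3)
        + (z - (v\<^sup>2 + \<mu>) * y * s) * (p1 * q2 - q1 * p2))
     = lopatinskii_functional u v C D a b t N \<mu> x0 y x1 z"
proof -
  have i2: "\<i>\<^sup>2 = -1" by simp
  show ?thesis unfolding lopatinskii_functional_def Let_def p1_def p2_def p3_def q1_def q2_def q3_def assms(1)[symmetric]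
    using i2 by Groebner_Basis.algebra
qed

lemma lopatinskii_functional_J:
  "lopatinskii_functional u v C D a b t N \<mu> (R * t) (u * v * R) 0 ((\<mu> * R - u * v * R) * t)
     = (t\<^sup>2 + v\<^sup>2 * N) * R * (v - u) * (u * v * a * b + C * D * t\<^sup>2)"
  unfolding lopatinskii_functional_def Let_def by Groebner_Basis.algebra

text \<open>
  The argument \<open>H R\<^sub>1\<^sup>+\<close> is the conjugate of \<open>H R\<^sub>1\<^sup>-\<close>, and \<open>w = 0\<close>.  Adding the second column of the
  determinant to the first therefore leaves \<open>(- 2 a, - 2 u a, 0)\<close>.  The next lemma is the analogue for the
  right state.
\<close>

lemma lopatinskii_functional_R1_plus:
  "lopatinskii_functional u v C D a b t N \<mu> (- a) (- \<i> * u * C) (- u * a + \<i> * C * t) (\<i> * u * C * t - \<mu> * a)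
     = - 2 * \<i> * a * (v - u) * (t\<^sup>2 + v\<^sup>2 * N) * C * (u * b - \<i> * D * t)"
proof -
  have i2: "\<i>^2 = -1" by simp
  show ?thesis unfolding lopatinskii_functional_def Let_def using i2 by Groebner_Basis.algebra
qed

lemma lopatinskii_functional_R2_plus:
  "lopatinskii_functional u v C D a b t N \<mu> b (\<i> * v * D) (v * b - \<i> * D * t) (\<mu> * b - \<i> * v * D * t)
     = 2 * \<i> * b * (v - u) * (t\<^sup>2 + v\<^sup>2 * N) * D * (v * a - \<i> * C * t)"
proof -
  have i2: "\<i>^2 = -1" by simp
  show ?thesis unfolding lopatinskii_functional_def Let_def using i2 by Groebner_Basis.algebra
qed

lemma lopatinskii_functional_R3_plus:
  assumes "u * v * a * b + C * D * t\<^sup>2 = 0"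
  shows "t * lopatinskii_functional u v C D a b t N \<mu> (u * N) (u * t) (2 * u\<^sup>2 * N) ((u\<^sup>2 + \<mu>) * u * N)
     = - (v - u) * N * (u * b - \<i> * D * t) * (u * a - \<i> * C * t)
         * (u * (t\<^sup>2 + v\<^sup>2 * N) - v * (t\<^sup>2 + u\<^sup>2 * N))"
proof -
  have i2: "\<i>^2 = -1" by simp
  show ?thesis unfolding lopatinskii_functional_def Let_def using i2 assms by Groebner_Basis.algebra
qed

lemma lopatinskii_functional_time_jump:
  assumes "u * v * a * b + C * D * t\<^sup>2 = 0"
  shows "t * lopatinskii_functional u v C D a b t N \<mu> R 0 0 (\<mu> * R - u * v * R)
     = - R * (v - u) * v\<^sup>2 * N * (u * b - \<i> * D * t) * (u * a - \<i> * C * t)"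
proof -
  have i2: "\<i>^2 = -1" by simp
  show ?thesis unfolding lopatinskii_functional_def Let_def using i2 assms by Groebner_Basis.algebra
qed

lemma acoustic_modulus:
  fixes u C a t N :: complex
  assumes "a\<^sup>2 = C * ((C - u\<^sup>2) * N - t\<^sup>2)"
  shows "(u * a - \<i> * C * t) * (u * a + \<i> * C * t) = C * (C - u\<^sup>2) * (t\<^sup>2 + u\<^sup>2 * N)"
proof -
  have i2: "\<i>^2 = -1" by simp
  show ?thesis using i2 assms by Groebner_Basis.algebra
qed

text \<open>
  The evaluation of \<open>\<alpha>\<^sub>0 / (- Upsilon)\<close>.  Here \<open>S0\<close> is the functional at the time jump and \<open>S1, S2, S3\<close> are its values
  at \<open>H R\<^sub>1\<^sup>+, H R\<^sub>2\<^sup>+, H R\<^sub>3\<^sup>+\<close>; the fractions next to \<open>g1, g2\<close> are the pairings of left and right modes, and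
  the outer denominators are the differences of the exponents \<open>\<beta>\<close>.
\<close>

lemma mode_sum_at_root:
  fixes u v C D a b t N R :: complex
  assumes F: "u * v * a * b + C * D * t\<^sup>2 = 0"
    and a2: "a\<^sup>2 = C * ((C - u\<^sup>2) * N - t\<^sup>2)" and b2: "b\<^sup>2 = D * ((D - v\<^sup>2) * N - t\<^sup>2)"
    and nz: "a \<noteq> 0" "b \<noteq> 0" "C \<noteq> 0" "D \<noteq> 0" "u \<noteq> 0" "v \<noteq> 0" "t \<noteq> 0" "C - u\<^sup>2 \<noteq> 0" "D - v\<^sup>2 \<noteq> 0"
       "t\<^sup>2 + u\<^sup>2 * N \<noteq> 0" "t\<^sup>2 + v\<^sup>2 * N \<noteq> 0"
       "u * a - \<i> * C * t \<noteq> 0" "v * b - \<i> * D * t \<noteq> 0"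
       "u * a + \<i> * C * t \<noteq> 0" "v * b + \<i> * D * t \<noteq> 0"
       "u * b - \<i> * D * t \<noteq> 0" "v * a - \<i> * C * t \<noteq> 0"
    and g1: "g1 = R * v * t / (v * a - \<i> * C * t)" and g2: "g2 = - R * u * t / (u * b - \<i> * D * t)"
    and S0: "t * S0 = - R * (v - u) * v\<^sup>2 * N * (u * b - \<i> * D * t) * (u * a - \<i> * C * t)"
    and S1: "S1 = - 2 * \<i> * a * (v - u) * (t\<^sup>2 + v\<^sup>2 * N) * C * (u * b - \<i> * D * t)"
    and S2: "S2 = 2 * \<i> * b * (v - u) * (t\<^sup>2 + v\<^sup>2 * N) * D * (v * a - \<i> * C * t)"
    and S3: "t * S3 = - (v - u) * N * (u * b - \<i> * D * t) * (u * a - \<i> * C * t)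
         * (u * (t\<^sup>2 + v\<^sup>2 * N) - v * (t\<^sup>2 + u\<^sup>2 * N))"
  shows "S0 + \<i> * (S1 * (g1 * (C\<^sup>2 * N / (a * (u * a + \<i> * C * t)))) / (- (2 * a / (C - u\<^sup>2)))
       + S2 * (g2 * (- (D\<^sup>2 * N / (b * (v * b + \<i> * D * t))))) / (2 * b / (D - v\<^sup>2))
       + S3 * (g1 * (C * (u * a - \<i> * C * t) / (u * (C - u\<^sup>2) * (t\<^sup>2 + u\<^sup>2 * N))))
            / (- ((u * a - \<i> * C * t) / (u * (C - u\<^sup>2)))))
   = R * (v - u) * (t\<^sup>2 + v\<^sup>2 * N) / t * (u\<^sup>2 * v\<^sup>2 * (a\<^sup>2 / C + b\<^sup>2 / D) + 2 * C * D * t\<^sup>2)"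
proof -
  define k where "k = C - u\<^sup>2"
  define m where "m = D - v\<^sup>2"
  define P where "P = u * b - \<i> * D * t"
  define Q where "Q = v * a - \<i> * C * t"
  define q where "q = u * a - \<i> * C * t"
  define q' where "q' = u * a + \<i> * C * t"
  define r where "r = v * b - \<i> * D * t"
  define r' where "r' = v * b + \<i> * D * t"
  define L where "L = t\<^sup>2 + u\<^sup>2 * N"
  define M where "M = t\<^sup>2 + v\<^sup>2 * N"
  note ds = k_def m_def P_def Q_def q_def q'_def r_def r'_def L_def M_def
  note nz' = nz[folded ds]
  have i2: "\<i>^2 = -1" by simp
  have qq: "q * q' = C * k * L" using acoustic_modulus[OF a2] by (simp add: ds)
  have rr: "r * r' = D * m * M" using acoustic_modulus[OF b2] by (simp add: ds)
  have Q': "Q * (u * b) = - \<i> * C * t * P" unfolding ds using F i2 by Groebner_Basis.algebra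
  have P': "P * (v * a) = - \<i> * D * t * Q" unfolding ds using F i2 by Groebner_Basis.algebra
  \<comment> \<open>At a root the denominators \<open>Q\<close> of \<open>g1\<close> and \<open>P\<close> of \<open>g2\<close> are proportional, so each can be exchanged
    for the one that occurs in \<open>S1\<close> and \<open>S2\<close>.\<close>
  have g1': "g1 * C * P = \<i> * R * u * v * b"
  proof -
    have "g1 * Q = R * v * t" using g1 nz' by (simp add: Q_def)
    then have "t * (g1 * C * P) = t * (\<i> * R * u * v * b)" using Q' i2 by Groebner_Basis.algebra
    then show ?thesis using \<open>t \<noteq> 0\<close> by (metis mult_left_cancel)
  qed
  have g2': "g2 * D * Q = - \<i> * R * u * v * a"
  proof -
    have "g2 * P = - R * u * t" using g2 nz' by (simp add: P_def)
    then have "t * (g2 * D * Q) = t * (- \<i> * R * u * v * a)" using P' i2 by Groebner_Basis.algebra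
    then show ?thesis using \<open>t \<noteq> 0\<close> by (metis mult_left_cancel)
  qed
  have T1: "\<i> * (S1 * (g1 * (C\<^sup>2 * N / (a * q'))) / (- (2 * a / k)))
     = - \<i> * R * (v - u) * u * v * b * C * N * q * M / (a * L)"
  proof -
    have "\<i> * (S1 * (g1 * (C\<^sup>2 * N / (a * q'))) / (- (2 * a / k)))
       = - (M * (v - u) * (g1 * C * P) * (k * C^2 * N) / (a * q'))"
      unfolding S1[folded ds] using nz' by (simp add: field_simps power2_eq_square)
    also have "\<dots> = - (M * (v - u) * (\<i> * R * u * v * b) * (k * C\<^sup>2 * N) * q / (a * (q * q')))"
      unfolding g1' using nz' by (simp add: field_simps)
    also have "\<dots> = - \<i> * R * (v - u) * u * v * b * C * N * q * M / (a * L)"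
      unfolding qq using nz' by (simp add: field_simps power2_eq_square)
    finally show ?thesis .
  qed
  have T2: "\<i> * (S2 * (g2 * (- (D\<^sup>2 * N / (b * r')))) / (2 * b / m))
     = - \<i> * R * (v - u) * u * v * a * D * N * r / b"
  proof -
    have "\<i> * (S2 * (g2 * (- (D\<^sup>2 * N / (b * r')))) / (2 * b / m))
       = M * (v - u) * (g2 * D * Q) * (m * D^2 * N) / (b * r')"
      unfolding S2[folded ds] using nz' by (simp add: field_simps power2_eq_square)
    also have "\<dots> = M * (v - u) * (- \<i> * R * u * v * a) * (m * D\<^sup>2 * N) * r / (b * (r * r'))"
      unfolding g2' using nz' by (simp add: field_simps)
    also have "\<dots> = - \<i> * R * (v - u) * u * v * a * D * N * r / b"
      unfolding rr using nz' by (simp add: field_simps power2_eq_square)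
    finally show ?thesis .
  qed
  have T3: "\<i> * (S3 * (g1 * (C * q / (u * k * L))) / (- (q / (u * k))))
     = - R * (v - u) * u * v * b * N * q * (u * M - v * L) / (L * t)"
  proof -
    have "\<i> * (S3 * (g1 * (C * q / (u * k * L))) / (- (q / (u * k))))
       = - \<i> * (t * S3) * g1 * C / (L * t)"
      using nz' by (simp add: field_simps)
    also have "\<dots> = \<i> * (v - u) * N * (g1 * C * P) * q * (u * M - v * L) / (L * t)"
      unfolding S3[folded ds] using nz' by (simp add: field_simps)
    also have "\<dots> = - R * (v - u) * u * v * b * N * q * (u * M - v * L) / (L * t)"
      unfolding g1' using nz' by (simp add: field_simps)
    finally show ?thesis .
  qed
  have T0: "S0 = - R * (v - u) * v\<^sup>2 * N * P * q / t"
    using S0[folded ds] nz by (simp add: field_simps)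
  \<comment> \<open>The terms with denominator \<open>L\<close> combine to a multiple of \<open>q q'\<close>, the others to a multiple of
    \<open>r r'\<close>; the two moduli then cancel \<open>L\<close> and supply the missing factor \<open>M\<close>.\<close>
  have "S0 + (- \<i> * R * (v - u) * u * v * b * C * N * q * M / (a * L)
       + - \<i> * R * (v - u) * u * v * a * D * N * r / b
       + - R * (v - u) * u * v * b * N * q * (u * M - v * L) / (L * t))
     = - R * (v - u) * v * N * (v * P * q / t + \<i> * u * b * C * q * M / (a * L)
        + \<i> * u * a * D * r / b + u * b * q * (u * M - v * L) / (L * t))"
    unfolding T0 using nz' by (simp add: field_simps power2_eq_square)
  also have "v * P * q / t + \<i> * u * b * C * q * M / (a * L)
        + \<i> * u * a * D * r / b + u * b * q * (u * M - v * L) / (L * t)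
     = u * b * M * (q * q') / (L * t * a) + \<i> * D * (u * a * r - v * b * q) / b"
  proof -
    have "v * P * q / t + u * b * q * (u * M - v * L) / (L * t)
        = u\<^sup>2 * b * M * q / (L * t) - \<i> * v * D * q"
      using nz' unfolding P_def by (simp add: field_simps power2_eq_square)
    moreover have "\<i> * u * b * C * q * M / (a * L) + u\<^sup>2 * b * M * q / (L * t)
        = u * b * M * (q * q') / (L * t * a)"
      using nz' unfolding q'_def by (simp add: field_simps power2_eq_square)
    moreover have "\<i> * u * a * D * r / b - \<i> * v * D * q = \<i> * D * (u * a * r - v * b * q) / b"
      using nz' by (simp add: field_simps)
    moreover have "x1 + w + g + x2 = z' + h" if "x1 + x2 = y - z" "w + y = z'" "g - z = h"
      for x1 x2 y z w z' g h :: complex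
      using that by Groebner_Basis.algebra
    ultimately show ?thesis by blast
  qed
  also have "\<i> * D * (u * a * r - v * b * q) / b = u * a * (D * m * M) / (b * t)"
  proof -
    have "\<i> * D * (u * a * r - v * b * q) * t = u * a * (r * r')"
      unfolding ds using F i2 by Groebner_Basis.algebra
    then show ?thesis unfolding rr using nz' by (simp add: field_simps)
  qed
  also have "u * b * M * (q * q') / (L * t * a) = u * b * (C * k * M) / (a * t)"
    unfolding qq using nz' by (simp add: field_simps)
  also have "- R * (v - u) * v * N * (u * b * (C * k * M) / (a * t) + u * a * (D * m * M) / (b * t))
     = - R * (v - u) * M / t * (u * v * (b * (C * k * N) / a + a * (D * m * N) / b))"
    using nz' by (simp add: field_simps)
  also have "u * v * (b * (C * k * N) / a + a * (D * m * N) / b)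
     = - (u\<^sup>2 * v\<^sup>2 * (a\<^sup>2 / C + b\<^sup>2 / D) + 2 * C * D * t\<^sup>2)"
  proof -
    have k: "C * k * N = a\<^sup>2 + C * t\<^sup>2" unfolding k_def using a2 by Groebner_Basis.algebra
    have m: "D * m * N = b\<^sup>2 + D * t\<^sup>2" unfolding m_def using b2 by Groebner_Basis.algebra
    have 1: "u * v * b * (C * t\<^sup>2) / a = - (u\<^sup>2 * v\<^sup>2 * b\<^sup>2 / D)"
    proof -
      have "u * v * b * (C * t\<^sup>2) * D = - (u\<^sup>2 * v\<^sup>2 * b\<^sup>2) * a" using F by Groebner_Basis.algebra
      then show ?thesis using nz by (simp add: field_simps)
    qed
    have 2: "u * v * a * (D * t\<^sup>2) / b = - (u\<^sup>2 * v\<^sup>2 * a\<^sup>2 / C)"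
    proof -
      have "u * v * a * (D * t\<^sup>2) * C = - (u\<^sup>2 * v\<^sup>2 * a\<^sup>2) * b" using F by Groebner_Basis.algebra
      then show ?thesis using nz by (simp add: field_simps)
    qed
    have 3: "u * v * a * b = - (C * D * t\<^sup>2)" using F by Groebner_Basis.algebra
    have "u * v * (b * (C * k * N) / a + a * (D * m * N) / b)
      = 2 * (u * v * a * b) + u * v * b * (C * t\<^sup>2) / a + u * v * a * (D * t\<^sup>2) / b"
      unfolding k m using nz by (simp add: field_simps power2_eq_square)
    then show ?thesis unfolding 1 2 3 by (simp add: algebra_simps)
  qed
  moreover have "- R * (v - u) * M / t * - X = R * (v - u) * M / t * X" for X :: complex
    by simp
  ultimately show ?thesis unfolding ds[symmetric] distrib_left[of \<i>] T1 T2 T3 by (simp only:)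
qed

section \<open>The linearised normal flux\<close>

text \<open>
  Since the transverse momentum vanishes at the state, \<open>\<bar>j\<bar>\<^sup>2\<close> depends to first order on \<open>j\<^sub>d\<close> only.  In the energy row the free energy is differentiated by means of \<open>f' = p / \<rho>\<^sup>2\<close>, that is \<open>\<rho> g' = p'\<close>.
\<close>

lemma jacobian_normal_flux:
  fixes p f :: "real \<Rightarrow> real" and \<rho> u :: real and n :: nat
  defines "c2 \<equiv> deriv p \<rho>" and "\<mu> \<equiv> u\<^sup>2 / 2 + gibbs p f \<rho>"
  assumes \<rho>: "0 < \<rho>" and p: "smooth_law p" and f: "specific_free_energy p f"
    and i: "i < n + 3" and k: "k < n + 2"
  shows "jacobian (n + 3) (n + 2) (full_flux (n + 1) p f (n + 1)) (stack \<rho> (0\<^sub>v n) (\<rho> * u)) $$ (i, k) =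
    (if i = 0 then (if k = n + 1 then 1 else 0)
     else if i \<le> n then (if k = i then u else 0)
     else if i = n + 1 then (if k = 0 then c2 - u\<^sup>2 else if k = n + 1 then 2 * u else 0)
     else (if k = 0 then (c2 - u\<^sup>2) * u else if k = n + 1 then u\<^sup>2 + \<mu> else 0))"
proof -
  define x where "x = (\<lambda>s. stack \<rho> (0\<^sub>v n) (\<rho> * u) + s \<cdot>\<^sub>v unit_vec (n + 2) k)"
  define d0 :: real where "d0 = (if k = 0 then 1 else 0)"
  define d1 :: real where "d1 = (if k = n + 1 then 1 else 0)"
  define dt :: "nat \<Rightarrow> real" where "dt = (\<lambda>i. if k = i then 1 else 0)"
  have x: "x s $ 0 = \<rho> + s * d0" "x s $ (n + 1) = \<rho> * u + s * d1"
    "1 \<le> i \<Longrightarrow> i \<le> n \<Longrightarrow> x s $ i = s * dt i" for s i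
    using k by (auto simp: x_def d0_def d1_def dt_def)
  have dim_x: "dim_vec (x s) = n + 2" for s by (simp add: x_def)
  define T where "T = (\<Sum>i=1..n. (dt i)\<^sup>2)"
  have mom: "momentum_sq (n + 1) (x s) = (\<rho> * u + s * d1)\<^sup>2 + s\<^sup>2 * T" for s
    unfolding momentum_sq_def T_def sum_distrib_left by (simp add: x x(2)[simplified] power_mult_distrib)
  have dp: "(p has_field_derivative c2) (at \<rho>)"
    using p[unfolded smooth_law_def, rule_format, of \<rho> 0] \<rho> unfolding c2_def
    by (simp add: field_differentiable_derivI)
  have df: "(f has_field_derivative p \<rho> / \<rho>\<^sup>2) (at \<rho>)"
    using f[unfolded specific_free_energy_def, rule_format, of \<rho>] \<rho>
    by (auto dest!: field_differentiable_derivI simp: field_simps)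
  have lin: "((\<lambda>s. \<rho> + s * d0) has_field_derivative d0) (at 0)" by (auto intro!: derivative_eq_intros)
  have dp': "((\<lambda>s. p (\<rho> + s * d0)) has_field_derivative c2 * d0) (at 0)"
    using DERIV_chain2[OF _ lin, of p c2] dp by simp
  have df': "((\<lambda>s. f (\<rho> + s * d0)) has_field_derivative p \<rho> / \<rho>\<^sup>2 * d0) (at 0)"
    using DERIV_chain2[OF _ lin, of f "p \<rho> / \<rho>\<^sup>2"] df by simp
  have jac: "jacobian (n + 3) (n + 2) (full_flux (n + 1) p f (n + 1)) (stack \<rho> (0\<^sub>v n) (\<rho> * u)) $$ (i, k)
     = deriv (\<lambda>s. full_flux (n + 1) p f (n + 1) (x s) $ i) 0"
    using i k by (simp add: jacobian_def x_def)
  consider "i = 0" | "1 \<le> i" "i \<le> n" | "i = n + 1" | "i = n + 2" using i by linarith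
  then show ?thesis
  proof cases
    case 1
    have "((\<lambda>s. full_flux (n + 1) p f (n + 1) (x s) $ i) has_field_derivative d1) (at 0)"
      unfolding 1 full_flux_def flux_def using x(2) by (auto intro!: derivative_eq_intros)
    then show ?thesis unfolding jac by (simp add: DERIV_imp_deriv d1_def 1)
  next
    case 2
    have eq: "(\<lambda>s. full_flux (n + 1) p f (n + 1) (x s) $ i) = (\<lambda>s. (\<rho> * u + s * d1) * (s * dt i) / (\<rho> + s * d0))"
      unfolding full_flux_def flux_def using 2 x by auto
    have "((\<lambda>s. full_flux (n + 1) p f (n + 1) (x s) $ i) has_field_derivative u * dt i) (at 0)"
      unfolding eq using \<rho> by (auto intro!: derivative_eq_intros simp: field_simps)
    then show ?thesis unfolding jac using 2 by (simp add: DERIV_imp_deriv dt_def)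
  next
    case 3
    have eq: "(\<lambda>s. full_flux (n + 1) p f (n + 1) (x s) $ i)
       = (\<lambda>s. (\<rho> * u + s * d1) * (\<rho> * u + s * d1) / (\<rho> + s * d0) + p (\<rho> + s * d0))"
      unfolding full_flux_def flux_def using 3 x by auto
    have "((\<lambda>s. full_flux (n + 1) p f (n + 1) (x s) $ i) has_field_derivative (c2 - u\<^sup>2) * d0 + 2 * u * d1) (at 0)"
      unfolding eq using \<rho>
      by (auto intro!: derivative_eq_intros dp' simp: field_simps power2_eq_square)
    then show ?thesis unfolding jac using 3 by (simp add: DERIV_imp_deriv d0_def d1_def)
  next
    case 4
    have eq: "(\<lambda>s. full_flux (n + 1) p f (n + 1) (x s) $ i)
       = (\<lambda>s. (((\<rho> * u + s * d1)\<^sup>2 + s\<^sup>2 * T) / (2 * (\<rho> + s * d0)\<^sup>2)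
            + (f (\<rho> + s * d0) + p (\<rho> + s * d0) / (\<rho> + s * d0))) * (\<rho> * u + s * d1))"
      unfolding full_flux_def flux_def energy_flux_def gibbs_def using 4 x mom by auto
    have "((\<lambda>s. full_flux (n + 1) p f (n + 1) (x s) $ i) has_field_derivative
         (c2 - u\<^sup>2) * u * d0 + (u\<^sup>2 + \<mu>) * d1) (at 0)"
      unfolding eq using \<rho>
      by (auto intro!: derivative_eq_intros dp' df' simp: \<mu>_def gibbs_def field_simps power2_eq_square)
    then show ?thesis unfolding jac using 4 by (simp add: DERIV_imp_deriv d0_def d1_def)
  qed
qed

lemma sum_one_point:
  fixes g :: "nat \<Rightarrow> 'a :: comm_ring_1"
  assumes "k < m"
  shows "(\<Sum>i<m. (if i = k then a else 0) * g i) = a * g k"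
proof -
  have "(\<Sum>i<m. (if i = k then a else 0) * g i) = (\<Sum>i<m. if i = k then a * g k else 0)"
    by (intro sum.cong) auto
  then show ?thesis using assms by simp
qed

lemma sum_two_points:
  fixes g :: "nat \<Rightarrow> 'a :: comm_ring_1"
  assumes "k < m" "l < m" "k \<noteq> l"
  shows "(\<Sum>i<m. (if i = k then a else if i = l then b else 0) * g i) = a * g k + b * g l"
proof -
  have "(\<Sum>i<m. (if i = k then a else if i = l then b else 0) * g i)
      = (\<Sum>i<m. (if i = k then a * g k else 0) + (if i = l then b * g l else 0))"
    using assms by (intro sum.cong) auto
  then show ?thesis using assms by (simp add: sum.distrib)
qed

locale reference_state =
  fixes B :: phase_boundary and n :: nat
  assumes reference: "reference_phase_boundary B" and dm_eq: "dm B = n + 1"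
begin

abbreviation "u \<equiv> u_l B"
abbreviation "v \<equiv> u_r B"
abbreviation "C \<equiv> (c_l B)\<^sup>2"
abbreviation "D \<equiv> (c_r B)\<^sup>2"
abbreviation "R \<equiv> rho_r B - rho_l B"

definition "\<mu> = u\<^sup>2 / 2 + gibbs (pressure B) (free_energy B) (rho_l B)"

lemma n_pos: "1 \<le> n"
  using reference dm_eq by (simp add: reference_phase_boundary_def)

lemma sound_speed: "C = deriv (pressure B) (rho_l B)" "D = deriv (pressure B) (rho_r B)"
  using reference by (auto simp: reference_phase_boundary_def c_l_def c_r_def)

lemma speeds_pos: "0 < u" "0 < v" "0 < c_l B" "0 < c_r B" "0 < C" "0 < D" "u\<^sup>2 < C" "v\<^sup>2 < D"
proof -
  show uv: "0 < u" "0 < v" and c: "0 < c_l B" "0 < c_r B"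
    using reference by (simp_all add: reference_phase_boundary_def c_l_def c_r_def)
  from c show "0 < C" "0 < D" by simp_all
  have "u < c_l B" "v < c_r B" using reference by (simp_all add: reference_phase_boundary_def)
  then show "u\<^sup>2 < C" "v\<^sup>2 < D" using uv by (simp_all add: power_strict_mono)
qed

lemma \<mu>_right: "\<mu> = v\<^sup>2 / 2 + gibbs (pressure B) (free_energy B) (rho_r B)"
  using reference by (simp add: reference_phase_boundary_def \<mu>_def)

lemma jump_pressure: "pressure B (rho_r B) - pressure B (rho_l B) = u * v * R"
proof -
  have j: "rho_l B * u = rho_r B * v"
    and m: "rho_l B * u\<^sup>2 + pressure B (rho_l B) = rho_r B * v\<^sup>2 + pressure B (rho_r B)"
    using reference unfolding reference_phase_boundary_def by blast+
  have "pressure B (rho_r B) - pressure B (rho_l B) = (rho_l B * u) * u - (rho_r B * v) * v"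
    using m by (simp add: power2_eq_square algebra_simps)
  also have "\<dots> = (rho_r B * v) * u - (rho_l B * u) * v" by (simp only: j)
  finally show ?thesis by (simp add: algebra_simps)
qed

lemma jumps_nonzero: "R \<noteq> 0" "v - u \<noteq> 0"
  using reference by (auto simp: reference_phase_boundary_def)

lemma normal_flux_row:
  fixes x0 x1 :: complex and y :: "complex vec"
  assumes "0 < \<rho>" "y \<in> carrier_vec n" "i < n + 3"
    and c2: "c2 = deriv (pressure B) \<rho>"
    and m: "\<mu> = w\<^sup>2 / 2 + gibbs (pressure B) (free_energy B) \<rho>"
  shows "(\<Sum>k<n + 2. complex_of_real (jacobian (dm B + 2) (dm B + 1)
        (full_flux (dm B) (pressure B) (free_energy B) (dm B)) (stack \<rho> (0\<^sub>v n) (\<rho> * w)) $$ (i, k))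
        * stack x0 y x1 $ k)
     = balance x1 (w \<cdot>\<^sub>v y) ((c2 - w\<^sup>2) * x0 + 2 * w * x1) ((c2 - w\<^sup>2) * w * x0 + (w\<^sup>2 + \<mu>) * x1) $ i"
proof -
  let ?J = "jacobian (n + 3) (n + 2) (full_flux (n + 1) (pressure B) (free_energy B) (n + 1))
       (stack \<rho> (0\<^sub>v n) (\<rho> * w))"
  have pf: "smooth_law (pressure B)" "specific_free_energy (pressure B) (free_energy B)"
    using reference by (auto simp: reference_phase_boundary_def)
  have J: "?J $$ (i, k) =
    (if i = 0 then (if k = n + 1 then 1 else 0)
     else if i \<le> n then (if k = i then w else 0)
     else if i = n + 1 then (if k = 0 then c2 - w\<^sup>2 else if k = n + 1 then 2 * w else 0)
     else (if k = 0 then (c2 - w\<^sup>2) * w else if k = n + 1 then w\<^sup>2 + \<mu> else 0))" if "k < n + 2" for k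
    unfolding c2 m using jacobian_normal_flux[OF assms(1) pf assms(3) that, of w] .
  have y: "dim_vec y = n" using assms by auto
  have "(\<Sum>k<n + 2. complex_of_real (?J $$ (i, k)) * stack x0 y x1 $ k)
    = (\<Sum>k<n + 2. complex_of_real (if i = 0 then (if k = n + 1 then 1 else 0)
     else if i \<le> n then (if k = i then w else 0)
     else if i = n + 1 then (if k = 0 then c2 - w\<^sup>2 else if k = n + 1 then 2 * w else 0)
     else (if k = 0 then (c2 - w\<^sup>2) * w else if k = n + 1 then w\<^sup>2 + \<mu> else 0)) * stack x0 y x1 $ k)"
    by (intro sum.cong refl) (simp only: J lessThan_iff)
  also have "\<dots> = balance x1 (w \<cdot>\<^sub>v y) ((c2 - w\<^sup>2) * x0 + 2 * w * x1) ((c2 - w\<^sup>2) * w * x0 + (w\<^sup>2 + \<mu>) * x1) $ i"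
  proof -
    consider "i = 0" | "1 \<le> i" "i \<le> n" | "i = n + 1" | "i = n + 2" using assms(3) by linarith
    then show ?thesis
    proof cases
      case 1
      then show ?thesis
        using y sum_one_point[of "n + 1" "n + 2" 1 "\<lambda>k. stack x0 y x1 $ k"]
        by (simp add: if_distrib[of complex_of_real] cong: if_cong)
    next
      case 2
      then show ?thesis
        using y sum_one_point[of i "n + 2" "complex_of_real w" "\<lambda>k. stack x0 y x1 $ k"]
        by (simp add: if_distrib[of complex_of_real] cong: if_cong)
    next
      case 3
      then show ?thesis using y sum_two_points[of 0 "n + 2" "n + 1" "complex_of_real (c2 - w\<^sup>2)"
          "complex_of_real (2 * w)" "\<lambda>k. stack x0 y x1 $ k"]
        by (simp add: if_distrib[of complex_of_real] cong: if_cong)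
    next
      case 4
      then show ?thesis using y sum_two_points[of 0 "n + 2" "n + 1" "complex_of_real ((c2 - w\<^sup>2) * w)"
          "complex_of_real (w\<^sup>2 + \<mu>)" "\<lambda>k. stack x0 y x1 $ k"]
        by (simp add: if_distrib[of complex_of_real] cong: if_cong)
    qed
  qed
  moreover have "n + 1 + 2 = n + 3" "n + 1 + 1 = n + 2" by simp_all
  ultimately show ?thesis
    by (simp only: dm_eq of_real_diff of_real_power of_real_mult of_real_numeral)
qed

lemma H_mult:
  assumes "x \<in> carrier_vec (n + 2)" "y \<in> carrier_vec (n + 2)" "i < n + 3"
  shows "(cmat (H_mat B) *\<^sub>v (x @\<^sub>v y)) $ i =
     (\<Sum>k<n + 2. complex_of_real (jacobian (dm B + 2) (dm B + 1)
        (full_flux (dm B) (pressure B) (free_energy B) (dm B)) (v_l B) $$ (i, k)) * x $ k)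
   - (\<Sum>k<n + 2. complex_of_real (jacobian (dm B + 2) (dm B + 1)
        (full_flux (dm B) (pressure B) (free_energy B) (dm B)) (v_r B) $$ (i, k)) * y $ k)"
proof -
  have split: "sum g {0..<m + m} = (\<Sum>k<m. g k) + (\<Sum>k<m. g (m + k))" for g :: "nat \<Rightarrow> complex" and m
    by (simp add: lessThan_atLeast0 sum.atLeastLessThan_concat[of 0 m "m + m", symmetric]
        sum.atLeastLessThan_shift_0[of g m "m + m"] add.commute)
  have d: "dm B = n + 1" by (rule dm_eq)
  have H: "dim_row (H_mat B) = n + 3" "dim_col (H_mat B) = (n + 2) + (n + 2)"
    using d by (auto simp: H_mat_def Let_def)
  have "(cmat (H_mat B) *\<^sub>v (x @\<^sub>v y)) $ i
      = (\<Sum>k=0..<(n + 2) + (n + 2). complex_of_real (H_mat B $$ (i, k)) * (x @\<^sub>v y) $ k)"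
    using assms H by (auto simp: scalar_prod_def intro!: sum.cong)
  also have "\<dots> = (\<Sum>k<n + 2. complex_of_real (H_mat B $$ (i, k)) * x $ k)
     + (\<Sum>k<n + 2. complex_of_real (H_mat B $$ (i, n + 2 + k)) * y $ k)"
    unfolding split using assms by (intro arg_cong2[of _ _ _ _ "(+)"] sum.cong) auto
  finally show ?thesis using d assms(3)
    by (simp add: H_mat_def Let_def sum_negf)
qed

lemma H_left:
  fixes x0 x1 :: complex
  assumes y: "y \<in> carrier_vec n"
  shows "cmat (H_mat B) *\<^sub>v on_left B (stack x0 y x1) =
    balance x1 (u \<cdot>\<^sub>v y) ((C - u\<^sup>2) * x0 + 2 * u * x1) ((C - u\<^sup>2) * u * x0 + (u\<^sup>2 + \<mu>) * x1)"
proof (rule eq_vecI)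
  have \<rho>: "0 < rho_l B" using reference by (simp add: reference_phase_boundary_def)
  fix i assume "i < dim_vec (balance x1 (u \<cdot>\<^sub>v y) ((C - u\<^sup>2) * x0 + 2 * u * x1) ((C - u\<^sup>2) * u * x0 + (u\<^sup>2 + \<mu>) * x1))"
  then have i: "i < n + 3" using y by simp
  have s: "stack x0 y x1 \<in> carrier_vec (n + 2)" "0\<^sub>v (dm B + 1) \<in> carrier_vec (n + 2)"
    using y by (intro carrier_vecI; simp add: dm_eq)+
  have z: "(\<Sum>k<n + 2. g k * (0\<^sub>v (dm B + 1) :: complex vec) $ k) = 0" for g
    by (intro sum.neutral) (simp add: dm_eq)
  show "(cmat (H_mat B) *\<^sub>v on_left B (stack x0 y x1)) $ i = balance x1 (u \<cdot>\<^sub>v y) ((C - u\<^sup>2) * x0 + 2 * u * x1) ((C - u\<^sup>2) * u * x0 + (u\<^sup>2 + \<mu>) * x1) $ i"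
    unfolding on_left_def H_mult[OF s i] z v_l_def
    using normal_flux_row[OF \<rho> y i sound_speed(1) \<mu>_def] by (simp add: dm_eq)
qed (use y dm_eq in \<open>simp add: H_mat_def Let_def\<close>)

lemma H_right:
  fixes x0 x1 :: complex
  assumes y: "y \<in> carrier_vec n"
  shows "cmat (H_mat B) *\<^sub>v on_right B (stack x0 y x1) =
    - balance x1 (v \<cdot>\<^sub>v y) ((D - v\<^sup>2) * x0 + 2 * v * x1) ((D - v\<^sup>2) * v * x0 + (v\<^sup>2 + \<mu>) * x1)"
proof (rule eq_vecI)
  have \<rho>: "0 < rho_r B" using reference by (simp add: reference_phase_boundary_def)
  fix i assume "i < dim_vec (- balance x1 (v \<cdot>\<^sub>v y) ((D - v\<^sup>2) * x0 + 2 * v * x1) ((D - v\<^sup>2) * v * x0 + (v\<^sup>2 + \<mu>) * x1))"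
  then have i: "i < n + 3" using y by simp
  have s: "stack x0 y x1 \<in> carrier_vec (n + 2)" "0\<^sub>v (dm B + 1) \<in> carrier_vec (n + 2)"
    using y by (intro carrier_vecI; simp add: dm_eq)+
  have z: "(\<Sum>k<n + 2. g k * (0\<^sub>v (dm B + 1) :: complex vec) $ k) = 0" for g
    by (intro sum.neutral) (simp add: dm_eq)
  show "(cmat (H_mat B) *\<^sub>v on_right B (stack x0 y x1)) $ i = (- balance x1 (v \<cdot>\<^sub>v y) ((D - v\<^sup>2) * x0 + 2 * v * x1) ((D - v\<^sup>2) * v * x0 + (v\<^sup>2 + \<mu>) * x1)) $ i"
    unfolding on_right_def H_mult[OF s(2,1) i] z v_r_def
    using normal_flux_row[OF \<rho> y i sound_speed(2) \<mu>_right] i y by (simp add: dm_eq)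
qed (use y dm_eq in \<open>simp add: H_mat_def Let_def\<close>)

lemma side_scalar_prod:
  assumes "dim_vec x = n + 2" "dim_vec y = n + 2"
  shows "conjugate (on_left B x) \<bullet> (k \<cdot>\<^sub>v on_left B y) = k * (conjugate x \<bullet> y)"
    and "conjugate (on_right B x) \<bullet> (k \<cdot>\<^sub>v on_right B y) = k * (conjugate x \<bullet> y)"
    and "conjugate (on_left B x) \<bullet> (k \<cdot>\<^sub>v on_right B y) = 0"
    and "conjugate (on_right B x) \<bullet> (k \<cdot>\<^sub>v on_left B y) = 0"
proof -
  have c: "x \<in> carrier_vec (n + 2)" "y \<in> carrier_vec (n + 2)" "0\<^sub>v (dm B + 1) \<in> carrier_vec (n + 2)"
    using assms by (intro carrier_vecI; simp add: dm_eq)+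
  define o' where "o' = (0\<^sub>v (dm B + 1) :: complex vec)"
  have o': "o' \<in> carrier_vec (n + 2)" using c(3) by (simp only: o'_def)
  have zero: "o' \<bullet> w = 0" "w \<bullet> o' = 0" if "w \<in> carrier_vec (n + 2)" for w
    using that by (auto simp: scalar_prod_def o'_def dm_eq)
  have x': "conjugate x \<in> carrier_vec (n + 2)" using c(1) by simp
  have dims: "dim_vec (conjugate x @\<^sub>v o') = dim_vec (y @\<^sub>v o')" "dim_vec (conjugate x @\<^sub>v o') = dim_vec (o' @\<^sub>v y)"
    "dim_vec (o' @\<^sub>v conjugate x) = dim_vec (y @\<^sub>v o')" "dim_vec (o' @\<^sub>v conjugate x) = dim_vec (o' @\<^sub>v y)"
    using assms o' by simp_all
  have sides: "conjugate (on_left B x) = conjugate x @\<^sub>v o'" "conjugate (on_right B x) = o' @\<^sub>v conjugate x"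
    "on_left B y = y @\<^sub>v o'" "on_right B y = o' @\<^sub>v y"
    by (simp_all add: on_left_def on_right_def conjugate_append_vec o'_def)
  show "conjugate (on_left B x) \<bullet> (k \<cdot>\<^sub>v on_left B y) = k * (conjugate x \<bullet> y)"
    unfolding sides scalar_prod_smult_right[OF dims(1)] scalar_prod_append[OF x' o' c(2) o'] zero(1)[OF o'] by simp
  show "conjugate (on_right B x) \<bullet> (k \<cdot>\<^sub>v on_right B y) = k * (conjugate x \<bullet> y)"
    unfolding sides scalar_prod_smult_right[OF dims(4)] scalar_prod_append[OF o' x' o' c(2)] zero(1)[OF o'] by simp
  show "conjugate (on_left B x) \<bullet> (k \<cdot>\<^sub>v on_right B y) = 0"
    unfolding sides scalar_prod_smult_right[OF dims(2)] scalar_prod_append[OF x' o' o' c(2)] zero(1)[OF c(2)] zero(2)[OF x'] by simp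
  show "conjugate (on_right B x) \<bullet> (k \<cdot>\<^sub>v on_left B y) = 0"
    unfolding sides scalar_prod_smult_right[OF dims(3)] scalar_prod_append[OF o' x' c(2) o'] zero(1)[OF c(2)] zero(2)[OF x'] by simp
qed

end

section \<open>The Lopatinskii determinant as a linear functional\<close>

locale frequency = reference_state +
  fixes \<eta> :: "real vec" and e :: "nat \<Rightarrow> real vec"
  assumes \<eta>: "\<eta> \<in> carrier_vec n" and N_pos: "0 < \<eta> \<bullet> \<eta>"
    and e1: "e 1 = \<eta>" and e: "\<And>k. \<lbrakk>1 \<le> k; k \<le> n\<rbrakk> \<Longrightarrow> e k \<in> carrier_vec n"
begin

abbreviation "N \<equiv> \<eta> \<bullet> \<eta>"
abbreviation "a t \<equiv> a_l B t \<eta>"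
abbreviation "b t \<equiv> a_r B t \<eta>"

lemma sonic_nonzero: "complex_of_real C - complex_of_real u ^ 2 \<noteq> 0" "complex_of_real D - complex_of_real v ^ 2 \<noteq> 0"
proof -
  have "complex_of_real (C - u\<^sup>2) \<noteq> 0" "complex_of_real (D - v\<^sup>2) \<noteq> 0"
    using speeds_pos by (simp_all only: of_real_eq_0_iff)
  then show "complex_of_real C - complex_of_real u ^ 2 \<noteq> 0" "complex_of_real D - complex_of_real v ^ 2 \<noteq> 0" by simp_all
qed

text \<open>
  With \<open>\<beta>\<^sub>1\<^sup>-\<close> and \<open>\<beta>\<^sub>2\<^sup>-\<close> substituted, the two acoustic right eigenvectors have the same form.
\<close>

lemma r1_minus_eq:
  "r1_minus B t \<eta> = stack ((u * a t - \<i> * C * t) / (C - u\<^sup>2)) ((\<i> * C) \<cdot>\<^sub>v cvec \<eta>) (- a t)"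
  using sonic_nonzero(1) unfolding r1_minus_def beta_minus_def
  by (simp add: field_simps power2_eq_square)

lemma r2_minus_eq:
  "r2_minus B t \<eta> = stack ((v * b t - \<i> * D * t) / (D - v\<^sup>2)) ((\<i> * D) \<cdot>\<^sub>v cvec \<eta>) (- b t)"
  using sonic_nonzero(2) unfolding r2_minus_def beta_minus_def
  by (simp add: field_simps power2_eq_square)

lemma H_R1_minus:
  "cmat (H_mat B) *\<^sub>v R_minus B e t \<eta> 1 =
    balance (- a t) ((\<i> * u * C) \<cdot>\<^sub>v cvec \<eta>) (- (u * a t) - \<i> * C * t) (- (\<i> * u * C * t) - \<mu> * a t)"
proof -
  have y: "(\<i> * C) \<cdot>\<^sub>v cvec \<eta> \<in> carrier_vec n" using \<eta> by simp
  show ?thesis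
    unfolding R_minus_def r1_minus_eq using sonic_nonzero(1)
    by (simp add: H_left[OF y, simplified] smult_smult_assoc)
      (intro balance_cong; simp add: field_simps power2_eq_square)
qed

lemma H_R2_minus:
  "cmat (H_mat B) *\<^sub>v R_minus B e t \<eta> 2 =
    balance (b t) ((- \<i> * v * D) \<cdot>\<^sub>v cvec \<eta>) (v * b t + \<i> * D * t) (\<i> * v * D * t + \<mu> * b t)"
proof -
  have y: "(\<i> * D) \<cdot>\<^sub>v cvec \<eta> \<in> carrier_vec n" using \<eta> by simp
  show ?thesis
    unfolding R_minus_def r2_minus_eq using sonic_nonzero(2)
    by (simp add: H_right[OF y, simplified] smult_smult_assoc uminus_balance uminus_smult_vec)
      (intro balance_cong; simp add: field_simps power2_eq_square)
qed

lemma H_R1_plus: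
  "cmat (H_mat B) *\<^sub>v R_plus B e t \<eta> 1 =
    balance (- a t) ((- \<i> * u * C) \<cdot>\<^sub>v cvec \<eta>) (- u * a t + \<i> * C * t) (\<i> * u * C * t - \<mu> * a t)"
proof -
  have y: "(- \<i> * C) \<cdot>\<^sub>v cvec \<eta> \<in> carrier_vec n" using \<eta> by simp
  show ?thesis
    unfolding R_plus_def r1_minus_eq using sonic_nonzero(1)
    by (simp add: H_left[OF y, simplified] smult_smult_assoc)
      (intro balance_cong; simp add: field_simps power2_eq_square)
qed

lemma H_R2_plus:
  "cmat (H_mat B) *\<^sub>v R_plus B e t \<eta> 2 =
    balance (b t) ((\<i> * v * D) \<cdot>\<^sub>v cvec \<eta>) (v * b t - \<i> * D * t) (\<mu> * b t - \<i> * v * D * t)"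
proof -
  have y: "(- \<i> * D) \<cdot>\<^sub>v cvec \<eta> \<in> carrier_vec n" using \<eta> by simp
  show ?thesis
    unfolding R_plus_def r2_minus_eq using sonic_nonzero(2)
    by (simp add: H_right[OF y, simplified] smult_smult_assoc uminus_balance uminus_smult_vec)
      (intro balance_cong; simp add: field_simps power2_eq_square)
qed

lemma H_R3_plus:
  "cmat (H_mat B) *\<^sub>v R_plus B e t \<eta> 3 =
    balance (u * N) ((u * t) \<cdot>\<^sub>v cvec \<eta>) (2 * u\<^sup>2 * N) ((u\<^sup>2 + \<mu>) * u * N)"
proof -
  have y: "complex_of_real t \<cdot>\<^sub>v cvec \<eta> \<in> carrier_vec n" using \<eta> by simp
  show ?thesis
    unfolding R_plus_def rj_plus_def
    by (simp add: e1[simplified] cvec_stack cvec_smult H_left[OF y] smult_smult_assoc)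
      (intro balance_cong; simp add: field_simps power2_eq_square)
qed

lemma H_R_minus_shear:
  assumes "1 \<le> k" "k \<le> n"
  shows "cmat (H_mat B) *\<^sub>v R_minus B e t \<eta> (k + 2) =
    balance (- (v * (\<eta> \<bullet> e k))) ((- (v * t)) \<cdot>\<^sub>v cvec (e k)) (- (2 * v\<^sup>2 * (\<eta> \<bullet> e k)))
      (- ((v\<^sup>2 + \<mu>) * v * (\<eta> \<bullet> e k)))"
proof -
  have y: "complex_of_real t \<cdot>\<^sub>v cvec (e k) \<in> carrier_vec n" using e[OF assms] by simp
  show ?thesis
    unfolding R_minus_def rj_minus_def using assms(1)
    by (simp add: cvec_stack cvec_smult H_right[OF y] smult_smult_assoc uminus_balance uminus_smult_vec)
      (intro balance_cong; simp add: field_simps power2_eq_square)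
qed

text \<open>
  The hypotheses of \<open>det_eliminate_block\<close> hold with \<open>W r i\<close> proportional to \<open>\<eta> $ i / t\<close>, since rows 0, \<open>d\<close> and \<open>d + 1\<close>
  of \<open>H R\<^sub>j\<^sup>-\<close>, for \<open>j \<ge> 3\<close>, are \<open>1\<close>, \<open>2 v\<close> and \<open>v\<^sup>2 + \<mu>\<close> times the same multiple of \<open>\<eta> \<bullet> e (j - 2)\<close>.
\<close>

lemma lopatinskii_det_eq:
  assumes t: "t \<noteq> 0"
  shows "lopatinskii_det B e t \<eta> (balance x0 (y \<cdot>\<^sub>v cvec \<eta>) x1 z)
    = - complex_of_real (Upsilon B e t) * lopatinskii_functional u v C D (a t) (b t) t N \<mu> x0 y x1 z"
proof -
  define cs where "cs = (\<lambda>j. cmat (H_mat B) *\<^sub>v R_minus B e t \<eta> j)"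
  define X where "X = balance x0 (y \<cdot>\<^sub>v cvec \<eta>) x1 z"
  define M where "M = mat_of_cols (dm B + 2) (X # map cs [1..<dm B + 2])"
  define E where "E = mat_of_cols n (map e [1..<dm B])"
  define T where "T = complex_of_real (- (v * t)) \<cdot>\<^sub>m cmat E"
  define w :: "nat \<Rightarrow> complex" where "w = (\<lambda>r. if r = 0 then 1 else if r = 1 then 2 * v else v\<^sup>2 + \<mu>)"
  define W where "W = (\<lambda>r i. w r * \<eta> $ i / t)"
  define S where "S = mat 3 3 (\<lambda>(r, j). M $$ (if r = 0 then 0 else n + r, j) - (\<Sum>i<n. W r i * M $$ (i + 1, j)))"
  have \<eta>_dim: "dim_vec \<eta> = n" using \<eta> by simp
  have M: "M \<in> carrier_mat (n + 3) (n + 3)" unfolding M_def dm_eq by (intro carrier_matI) simp_all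
  have T: "T \<in> carrier_mat n n" unfolding T_def E_def dm_eq by (intro carrier_matI) simp_all
  have M_col: "M $$ (i, 0) = X $ i" "M $$ (i, 1) = cs 1 $ i" "M $$ (i, 2) = cs 2 $ i"
    "k < n \<Longrightarrow> M $$ (i, k + 3) = cs (k + 1 + 2) $ i" if "i < n + 3" for i k
    using that n_pos unfolding M_def dm_eq
    by (auto simp: mat_of_cols_index nth_Cons' eval_nat_numeral nth_append simp del: upt_Suc)
  have T_entry: "T $$ (i, k) = - (v * t) * e (k + 1) $ i" if "i < n" "k < n" for i k
    using that unfolding T_def E_def dm_eq by (simp add: mat_of_cols_index nth_append del: upt_Suc)
  have inner: "complex_of_real (\<eta> \<bullet> x) = (\<Sum>i<n. complex_of_real (\<eta> $ i) * x $ i)" if "x \<in> carrier_vec n" for x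
    using that by (simp add: scalar_prod_def lessThan_atLeast0)
  have "det M = det T * det (mat 3 3 (\<lambda>(r, j). M $$ (if r = 0 then 0 else n + r, j) - (\<Sum>i<n. W r i * M $$ (i + 1, j))))"
  proof (rule det_eliminate_block[OF M T])
    fix i k assume ik: "i < n" "k < n"
    then have k: "1 \<le> k + 1" "k + 1 \<le> n" by auto
    from ik show "M $$ (i + 1, k + 3) = T $$ (i, k)"
      using e[OF k] by (simp add: M_col T_entry cs_def H_R_minus_shear[OF k, simplified])
  next
    fix r k :: nat assume r: "r < 3" and kn: "k < n"
    then have k: "1 \<le> k + 1" "k + 1 \<le> n" by auto
    have "(\<Sum>i<n. W r i * T $$ (i, k)) = (\<Sum>i<n. - (v * w r) * (complex_of_real (\<eta> $ i) * e (k + 1) $ i))"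
      using t kn by (intro sum.cong refl) (simp add: T_entry W_def)
    also have "\<dots> = - (v * w r) * (\<eta> \<bullet> e (k + 1))"
      by (simp only: sum_distrib_left[symmetric] inner[OF e[OF k]])
    finally have *: "(\<Sum>i<n. W r i * T $$ (i, k)) = - (v * w r) * (\<eta> \<bullet> e (k + 1))" .
    have "M $$ (if r = 0 then 0 else n + r, k + 3) = cs (k + 1 + 2) $ (if r = 0 then 0 else n + r)"
      using r kn by (intro M_col) auto
    also have "\<dots> = - (v * w r) * (\<eta> \<bullet> e (k + 1))"
    proof -
      have d: "dim_vec (e (Suc k)) = n" using e[OF k] by simp
      consider "r = 0" | "r = 1" | "r = 2" using r by linarith
      then show ?thesis unfolding cs_def H_R_minus_shear[OF k]
        by cases (use d in \<open>simp_all add: w_def power2_eq_square\<close>)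
    qed
    finally show "M $$ (if r = 0 then 0 else n + r, k + 3) = (\<Sum>i<n. W r i * T $$ (i, k))" using * by simp
  qed
  also have "det T = (- (v * t)) ^ n * det E"
    unfolding T_def using n_pos by (simp add: E_def dm_eq of_real_hom.hom_det)
  finally have det_M: "det M = (- (v * t)) ^ n * det E * det S"
    unfolding S_def .
  define s where "s = complex_of_real (N / t)"
  have s: "t * s = N" using t by (simp add: s_def)
  have reduce: "(\<Sum>i<n. W r i * balance p0 (q \<cdot>\<^sub>v cvec \<eta>) p1 p2 $ (i + 1)) = w r * q * s" for r p0 p1 p2 q
  proof -
    have "(\<Sum>i<n. W r i * balance p0 (q \<cdot>\<^sub>v cvec \<eta>) p1 p2 $ (i + 1))
       = (\<Sum>i<n. w r * q / t * (complex_of_real (\<eta> $ i) * \<eta> $ i))"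
      using \<eta>_dim by (intro sum.cong refl) (simp add: W_def)
    also have "\<dots> = w r * q / t * N" by (simp only: sum_distrib_left[symmetric] inner[OF \<eta>])
    finally show ?thesis by (simp add: s_def)
  qed
  have S_entry: "S $$ (0, j) = p0 - q * s \<and> S $$ (1, j) = p1 - 2 * v * q * s \<and> S $$ (2, j) = p2 - (v\<^sup>2 + \<mu>) * q * s"
    if "j < 3" "\<And>i. i < n + 3 \<Longrightarrow> M $$ (i, j) = balance p0 (q \<cdot>\<^sub>v cvec \<eta>) p1 p2 $ i" for j and p0 q p1 p2 :: complex
  proof -
    have "(\<Sum>i<n. W r i * M $$ (i + 1, j)) = w r * q * s" for r
      unfolding reduce[of r p0 q p1 p2, symmetric] by (intro sum.cong refl) (simp add: that(2))
    then have "S $$ (r, j) = balance p0 (q \<cdot>\<^sub>v cvec \<eta>) p1 p2 $ (if r = 0 then 0 else n + r) - w r * q * s"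
      if "r < 3" for r
      using \<open>j < 3\<close> that \<open>\<And>i. i < n + 3 \<Longrightarrow> M $$ (i, j) = _ i\<close> by (simp add: S_def)
    from this[of 0] this[of 1] this[of 2] \<eta>_dim show ?thesis by (simp add: w_def)
  qed
  note S0 = S_entry[OF _ M_col(1)[unfolded X_def], simplified]
  note S1 = S_entry[OF _ M_col(2)[unfolded cs_def H_R1_minus], simplified]
  note S2 = S_entry[OF _ M_col(3)[unfolded cs_def H_R2_minus], simplified]
  have S_car: "S \<in> carrier_mat 3 3" by (simp add: S_def)
  have t_det: "t * det S = lopatinskii_functional u v C D (a t) (b t) t N \<mu> x0 y x1 z"
    unfolding det_3[OF S_car] lopatinskii_functional_as_det[OF s, symmetric]
    by (simp add: S0 S1 S2)
  \<comment> \<open>\<open>Upsilon\<close> contains \<open>(- v t) ^ (n - 1) v\<close>, while the block contributes \<open>(- v t) ^ n\<close>.\<close>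
  have U: "complex_of_real (Upsilon B e t) * (- t) = (- (v * t)) ^ n * det E"
  proof -
    obtain m where "n = Suc m" using n_pos by (cases n) auto
    then show ?thesis unfolding Upsilon_def E_def dm_eq by simp
  qed
  have "lopatinskii_det B e t \<eta> X = det M"
    unfolding lopatinskii_det_def M_def cs_def ..
  also have "\<dots> = - complex_of_real (Upsilon B e t) * (t * det S)"
    unfolding det_M U[symmetric] by simp
  finally show ?thesis unfolding X_def t_det .
qed

end

section \<open>The zeros of the Lopatinskii determinant\<close>

lemma full_flux_normal_state:
  fixes p f :: "real \<Rightarrow> real" and \<rho> w :: real
  assumes "0 < \<rho>" "i < n + 3"
  shows "full_flux (n + 1) p f 0 (stack \<rho> (0\<^sub>v n) (\<rho> * w)) $ i =
      balance \<rho> (0\<^sub>v n) (\<rho> * w) (\<rho> * (w\<^sup>2 / 2 + gibbs p f \<rho>) - p \<rho>) $ i"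
    and "\<lbrakk>1 \<le> k; k \<le> n\<rbrakk> \<Longrightarrow>
      full_flux (n + 1) p f k (stack \<rho> (0\<^sub>v n) (\<rho> * w)) $ i = (if i = k then p \<rho> else 0)"
proof -
  let ?v = "stack \<rho> (0\<^sub>v n) (\<rho> * w)"
  have idx: "?v $ 0 = \<rho>" "\<And>k. 1 \<le> k \<Longrightarrow> k \<le> n \<Longrightarrow> ?v $ k = 0" "?v $ (n + 1) = \<rho> * w" by auto
  have mom: "momentum_sq (n + 1) ?v = (\<rho> * w)\<^sup>2"
  proof -
    have "(\<Sum>k=1..n. (?v $ k)\<^sup>2) = 0" by (intro sum.neutral ballI) (simp only: idx atLeastAtMost_iff, simp)
    then show ?thesis unfolding momentum_sq_def by (simp add: idx(3)[simplified])
  qed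
  consider "i = 0" | "1 \<le> i" "i \<le> n" | "i = n + 1" | "i = n + 2" using assms(2) by linarith
  note cases = this
  from cases show "full_flux (n + 1) p f 0 ?v $ i =
      balance \<rho> (0\<^sub>v n) (\<rho> * w) (\<rho> * (w\<^sup>2 / 2 + gibbs p f \<rho>) - p \<rho>) $ i"
  proof cases
    case 4
    have "\<rho> * (w\<^sup>2 / 2 + gibbs p f \<rho>) - p \<rho> = (\<rho> * w)\<^sup>2 / (2 * \<rho>) + \<rho> * f \<rho>"
      using assms(1) by (simp add: gibbs_def field_simps power2_eq_square)
    then show ?thesis unfolding 4 full_flux_def flux_def energy_flux_def mom by (simp add: idx)
  qed (auto simp: full_flux_def flux_def idx)
  assume k: "1 \<le> k" "k \<le> n"
  from cases show "full_flux (n + 1) p f k ?v $ i = (if i = k then p \<rho> else 0)"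
    by cases (use k in \<open>auto simp: full_flux_def flux_def energy_flux_def idx\<close>)
qed

context frequency
begin

lemma jump_flux_time:
  "i < n + 3 \<Longrightarrow> jump_flux B 0 $ i = balance R (0\<^sub>v n) 0 (\<mu> * R - u * v * R) $ i"
proof -
  assume i: "i < n + 3"
  have \<rho>: "0 < rho_l B" "0 < rho_r B" and j: "rho_l B * u = rho_r B * v"
    using reference unfolding reference_phase_boundary_def by blast+
  have d: "dim_vec (full_flux (n + 1) (pressure B) (free_energy B) 0 (v_l B)) = n + 3"
    by (simp add: full_flux_def flux_def v_l_def dm_eq)
  have jump: "jump_flux B 0 $ i =
      balance (rho_r B) (0\<^sub>v n) (rho_r B * v) (rho_r B * \<mu> - pressure B (rho_r B)) $ i
    - balance (rho_l B) (0\<^sub>v n) (rho_l B * u) (rho_l B * \<mu> - pressure B (rho_l B)) $ i"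
    using full_flux_normal_state(1)[OF \<rho>(1) i, of "pressure B" "free_energy B" u, folded \<mu>_def]
      full_flux_normal_state(1)[OF \<rho>(2) i, of "pressure B" "free_energy B" v, folded \<mu>_right] i d
    by (simp add: jump_flux_def dm_eq v_l_def v_r_def)
  consider "i = 0" | "1 \<le> i" "i \<le> n" | "i = n + 1" | "i = n + 2" using i by linarith
  then show ?thesis unfolding jump
  proof cases
    case 2
    then have "i - 1 < n" by linarith
    with 2 show "balance (rho_r B) (0\<^sub>v n) (rho_r B * v) (rho_r B * \<mu> - pressure B (rho_r B)) $ i - balance (rho_l B) (0\<^sub>v n) (rho_l B * u) (rho_l B * \<mu> - pressure B (rho_l B)) $ i = balance R (0\<^sub>v n) 0 (\<mu> * R - u * v * R) $ i" by simp
  next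
    case 4
    then show "balance (rho_r B) (0\<^sub>v n) (rho_r B * v) (rho_r B * \<mu> - pressure B (rho_r B)) $ i - balance (rho_l B) (0\<^sub>v n) (rho_l B * u) (rho_l B * \<mu> - pressure B (rho_l B)) $ i = balance R (0\<^sub>v n) 0 (\<mu> * R - u * v * R) $ i" using jump_pressure by (simp add: algebra_simps)
  qed (use j in simp_all)
qed

lemma jump_flux_transverse:
  assumes "i < n + 3" "1 \<le> k" "k \<le> n"
  shows "jump_flux B k $ i = (if i = k then u * v * R else 0)"
proof -
  have \<rho>: "0 < rho_l B" "0 < rho_r B"
    using reference unfolding reference_phase_boundary_def by blast+
  have d: "dim_vec (full_flux (n + 1) (pressure B) (free_energy B) k (v_l B)) = n + 3"
    using assms(2) by (simp add: full_flux_def flux_def)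
  show ?thesis
    using full_flux_normal_state(2)[OF \<rho>(1) assms, of "pressure B" "free_energy B" u]
      full_flux_normal_state(2)[OF \<rho>(2) assms, of "pressure B" "free_energy B" v] assms d
    by (simp add: jump_flux_def dm_eq v_l_def v_r_def jump_pressure)
qed

lemma cvec_jump_flux_time:
  "cvec (jump_flux B 0) = balance (complex_of_real R) (0 \<cdot>\<^sub>v cvec \<eta>) 0 (\<mu> * R - u * v * R)"
proof (rule balance_eqI[of _ n])
  have d: "dim_vec (jump_flux B 0) = n + 3"
    by (simp add: jump_flux_def full_flux_def flux_def v_l_def dm_eq)
  then show "dim_vec (cvec (jump_flux B 0)) = n + 3" by simp
  show "dim_vec (0 \<cdot>\<^sub>v cvec \<eta>) = n" using \<eta> by simp
  show "cvec (jump_flux B 0) $ 0 = complex_of_real R"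
    "cvec (jump_flux B 0) $ (n + 1) = 0" "cvec (jump_flux B 0) $ (n + 2) = \<mu> * R - u * v * R"
    using d by (simp_all add: jump_flux_time)
  fix i assume i: "1 \<le> i" "i \<le> n"
  then have "i - 1 < n" by linarith
  then show "cvec (jump_flux B 0) $ i = (0 \<cdot>\<^sub>v cvec \<eta>) $ (i - 1)"
    using d i \<eta> by (simp add: jump_flux_time)
qed

lemma cvec_J_eta:
  "cvec (J_eta B t \<eta>) =
     balance (complex_of_real R * t) ((u * v * R) \<cdot>\<^sub>v cvec \<eta>) 0 ((\<mu> * R - u * v * R) * t)"
proof (rule balance_eqI[of _ n])
  have J: "J_eta B t \<eta> $ i = t * jump_flux B 0 $ i + (\<Sum>k<n. \<eta> $ k * (if i = k + 1 then u * v * R else 0))"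
    if "i < n + 3" for i
  proof -
    have "J_eta B t \<eta> $ i = (\<Sum>j<Suc n. (if j = 0 then t else \<eta> $ (j - 1)) * jump_flux B j $ i)"
      using that by (simp add: J_eta_def dm_eq)
    also have "\<dots> = t * jump_flux B 0 $ i + (\<Sum>k<n. \<eta> $ k * jump_flux B (k + 1) $ i)"
      unfolding sum.lessThan_Suc_shift by simp
    also have "(\<Sum>k<n. \<eta> $ k * jump_flux B (k + 1) $ i) = (\<Sum>k<n. \<eta> $ k * (if i = k + 1 then u * v * R else 0))"
      using that by (intro sum.cong refl) (simp add: jump_flux_transverse)
    finally show ?thesis .
  qed
  have d: "dim_vec (J_eta B t \<eta>) = n + 3" by (simp add: J_eta_def dm_eq)
  then show "dim_vec (cvec (J_eta B t \<eta>)) = n + 3" by simp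
  show "dim_vec ((u * v * R) \<cdot>\<^sub>v cvec \<eta>) = n" using \<eta> by simp
  show "cvec (J_eta B t \<eta>) $ 0 = complex_of_real R * t"
    using d J[of 0] by (simp add: jump_flux_time)
  have "(\<Sum>k<n. \<eta> $ k * (if n + 1 = k + 1 then u * v * R else 0)) = 0"
    "(\<Sum>k<n. \<eta> $ k * (if n + 2 = k + 1 then u * v * R else 0)) = 0"
    by (auto intro!: sum.neutral)
  with J[of "n + 1"] J[of "n + 2"] show "cvec (J_eta B t \<eta>) $ (n + 1) = 0"
    "cvec (J_eta B t \<eta>) $ (n + 2) = (\<mu> * R - u * v * R) * t"
    using d by (simp_all add: jump_flux_time)
  fix i assume i: "1 \<le> i" "i \<le> n"
  have "(\<Sum>k<n. \<eta> $ k * (if i = k + 1 then u * v * R else 0)) = (\<Sum>k<n. if k = i - 1 then \<eta> $ (i - 1) * (u * v * R) else 0)"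
    using i by (intro sum.cong) auto
  also have "\<dots> = \<eta> $ (i - 1) * (u * v * R)"
  proof -
    have "i - 1 < n" using i by linarith
    then show ?thesis by simp
  qed
  finally have "J_eta B t \<eta> $ i = \<eta> $ (i - 1) * (u * v * R)" using J[of i] i by (simp add: jump_flux_time)
  moreover have "i - 1 < n" using i by linarith
  ultimately show "cvec (J_eta B t \<eta>) $ i = ((u * v * R) \<cdot>\<^sub>v cvec \<eta>) $ (i - 1)"
    using d i \<eta> by simp
qed

text \<open>
  The frequency \<open>t\<close> ranges over a whole neighbourhood of the root, because this factorisation is going to be
  differentiated.
\<close>

lemma Delta_eq:
  assumes "t \<noteq> 0"
  shows "Delta B e t \<eta> = complex_of_real
    (- Upsilon B e t * (t\<^sup>2 + v\<^sup>2 * N) * R * (v - u) * (u * v * a t * b t + C * D * t\<^sup>2))"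
  unfolding Delta_def cvec_J_eta lopatinskii_det_eq[OF assms]
  using lopatinskii_functional_J[of u v C D "a t" "b t" t N \<mu> R] by simp

end

locale elliptic_mode = frequency +
  fixes t :: real and e' :: "nat \<Rightarrow> real vec"
  assumes t: "t \<noteq> 0" and elliptic: "t\<^sup>2 < (C - u\<^sup>2) * N" "t\<^sup>2 < (D - v\<^sup>2) * N"
    and e_orth: "\<And>k. \<lbrakk>2 \<le> k; k \<le> n\<rbrakk> \<Longrightarrow> e k \<bullet> \<eta> = 0"
    and e'_carrier: "\<And>k. \<lbrakk>2 \<le> k; k \<le> n\<rbrakk> \<Longrightarrow> e' k \<in> carrier_vec n"
    and e'_orth: "\<And>k. \<lbrakk>2 \<le> k; k \<le> n\<rbrakk> \<Longrightarrow> e' k \<bullet> \<eta> = 0"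
    and e'_dual: "\<And>k l. \<lbrakk>2 \<le> k; k \<le> n; 2 \<le> l; l \<le> n\<rbrakk> \<Longrightarrow> e' k \<bullet> e l = (if k = l then 1 else 0)"
begin

lemma a_sq: "(a t)\<^sup>2 = C * ((C - u\<^sup>2) * N - t\<^sup>2)" and b_sq: "(b t)\<^sup>2 = D * ((D - v\<^sup>2) * N - t\<^sup>2)"
  using elliptic by (simp_all add: a_l_def a_r_def power_mult_distrib)

lemma a_neg: "a t < 0" and b_pos: "0 < b t"
  using elliptic speeds_pos by (simp_all add: a_l_def a_r_def mult_pos_pos)

lemma M_pos: "0 < t\<^sup>2 + u\<^sup>2 * N" "0 < t\<^sup>2 + v\<^sup>2 * N"
  using t N_pos by (simp_all add: add_pos_nonneg)

text \<open>
  The matrix with rows \<open>\<eta>, e' 2, \<dots>, e' n\<close> is a left inverse of \<open>(e 1, \<dots>, e n)\<close> up to the factor \<open>N\<close> in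
  the first row, because both families are orthogonal to \<open>\<eta> = e 1\<close>.
\<close>

lemma det_transverse_basis_nonzero: "det (mat_of_cols n (map e [1..<dm B])) \<noteq> 0"
proof -
  define E where "E = mat_of_cols n (map e [1..<dm B])"
  define E' where "E' = mat n n (\<lambda>(k, i). (if k = 0 then \<eta> else e' (k + 1)) $ i)"
  have E: "E \<in> carrier_mat n n" unfolding E_def dm_eq by (intro carrier_matI) simp_all
  have E': "E' \<in> carrier_mat n n" by (simp add: E'_def)
  have colE: "col E l = e (l + 1)" if "l < n" for l
    using that e[of "l + 1"] unfolding E_def dm_eq by (simp add: nth_append del: upt_Suc)
  have rowE': "row E' k = (if k = 0 then \<eta> else e' (k + 1))" if "k < n" for k
    using that \<eta> e'_carrier[of "k + 1"] by (intro eq_vecI) (auto simp: E'_def)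
  have prod: "(E' * E) $$ (k, l) = (if k \<noteq> l then 0 else if k = 0 then N else 1)" if "k < n" "l < n" for k l
  proof -
    have "(E' * E) $$ (k, l) = (if k = 0 then \<eta> else e' (k + 1)) \<bullet> e (l + 1)"
      using that E E' by (simp add: colE rowE')
    moreover have "\<eta> \<bullet> e (l + 1) = (if l = 0 then N else 0)"
    proof (cases "l = 0")
      case False
      then have "\<eta> \<bullet> e (l + 1) = e (l + 1) \<bullet> \<eta>"
        using that by (intro comm_scalar_prod[OF \<eta>] e) auto
      then show ?thesis using e_orth[of "l + 1"] False that by simp
    qed (simp add: e1[simplified])
    moreover have "e' (k + 1) \<bullet> e (l + 1) = (if k = l then 1 else 0)" if "k \<noteq> 0"
    proof (cases "l = 0")
      case True
      then show ?thesis using e'_orth[of "k + 1"] \<open>k < n\<close> that by (simp add: e1[simplified])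
    next
      case False
      then show ?thesis using e'_dual[of "k + 1" "l + 1"] \<open>k < n\<close> \<open>l < n\<close> that by simp
    qed
    ultimately show ?thesis by (cases "k = 0") auto
  qed
  have PE: "E' * E \<in> carrier_mat n n" using E E' by simp
  have "det (E' * E) = prod_list (diag_mat (E' * E))"
    using E E' by (intro det_upper_triangular[OF _ PE] upper_triangularI) (simp add: prod del: index_mult_mat(1))
  also have "\<dots> \<noteq> 0"
    using E E' N_pos by (auto simp: prod_list_zero_iff diag_mat_def prod simp del: index_mult_mat(1) split: if_splits)
  finally show ?thesis using det_mult[OF E' E] unfolding E_def by auto
qed

lemma Upsilon_nonzero: "Upsilon B e t \<noteq> 0"
  using det_transverse_basis_nonzero t speeds_pos unfolding Upsilon_def by (simp add: dm_eq)

lemma root_iff: "Delta B e t \<eta> = 0 \<longleftrightarrow> u * v * a t * b t + C * D * t\<^sup>2 = 0"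
  using Upsilon_nonzero M_pos jumps_nonzero unfolding Delta_eq[OF t] of_real_eq_0_iff by auto

text \<open>
  As the factor \<open>F\<close> vanishes at the root, the derivative of the prefactor \<open>G\<close> does not contribute; its
  existence suffices.
\<close>

lemma Delta_derivative:
  assumes root: "u * v * a t * b t + C * D * t\<^sup>2 = 0"
  shows "((\<lambda>s. Delta B e s \<eta>) has_vector_derivative complex_of_real
      (- (R * (v - u) * Upsilon B e t / t) * (t\<^sup>2 + v\<^sup>2 * N)
        * (u\<^sup>2 * v\<^sup>2 * ((a t)\<^sup>2 / C + (b t)\<^sup>2 / D) + 2 * C * D * t\<^sup>2))) (at t)"
proof -
  define F where "F = (\<lambda>s. u * v * a s * b s + C * D * s\<^sup>2)"
  define G where "G = (\<lambda>s. - Upsilon B e s * (s\<^sup>2 + v\<^sup>2 * N) * R * (v - u))"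
  define F' where "F' = u * v * (- C * t / a t * b t - D * t / b t * a t) + 2 * C * D * t"
  have c: "c_l B \<noteq> 0" "c_r B \<noteq> 0" and nz: "a t \<noteq> 0" "b t \<noteq> 0" using speeds_pos a_neg b_pos by auto
  have da: "((\<lambda>s. a s) has_real_derivative - C * t / a t) (at t)"
  proof -
    have "((\<lambda>s. - c_l B * sqrt ((C - u\<^sup>2) * N - s\<^sup>2)) has_real_derivative - C * t / a t) (at t)"
      using elliptic c
      by (auto intro!: derivative_eq_intros simp: a_l_def field_simps power2_eq_square)
    then show ?thesis by (simp add: a_l_def)
  qed
  have db: "((\<lambda>s. b s) has_real_derivative - D * t / b t) (at t)"
  proof -
    have "((\<lambda>s. c_r B * sqrt ((D - v\<^sup>2) * N - s\<^sup>2)) has_real_derivative - D * t / b t) (at t)"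
      using elliptic c
      by (auto intro!: derivative_eq_intros simp: a_r_def field_simps power2_eq_square)
    then show ?thesis by (simp add: a_r_def)
  qed
  have dF: "(F has_real_derivative F') (at t)"
    unfolding F_def F'_def by (auto intro!: derivative_eq_intros da db simp: algebra_simps)
  have "\<exists>G'. (G has_real_derivative G') (at t)"
    unfolding G_def Upsilon_def by (rule exI) (rule derivative_eq_intros refl)+
  then obtain G' where dG: "(G has_real_derivative G') (at t)" ..
  have "F t = 0" using root by (simp add: F_def)
  then have "((\<lambda>s. G s * F s) has_real_derivative G t * F') (at t)"
    using DERIV_mult[OF dG dF] by (simp add: mult.commute)
  then have d: "((\<lambda>s. complex_of_real (G s * F s)) has_vector_derivative complex_of_real (G t * F')) (at t)"
    by (rule has_vector_derivative_of_real)
  have "((\<lambda>s. Delta B e s \<eta>) has_vector_derivative complex_of_real (G t * F')) (at t)"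
  proof (rule has_vector_derivative_transform_within_open[OF d])
    show "open (- {0 :: real})" "t \<in> - {0}" using t by auto
    show "complex_of_real (G s * F s) = Delta B e s \<eta>" if "s \<in> - {0}" for s
      using that by (simp add: Delta_eq G_def F_def)
  qed
  also have "G t * F' = - (R * (v - u) * Upsilon B e t / t) * (t\<^sup>2 + v\<^sup>2 * N) * (t * F')"
    using t by (simp add: G_def field_simps)
  also have "t * F' = u\<^sup>2 * v\<^sup>2 * ((a t)\<^sup>2 / C + (b t)\<^sup>2 / D) + 2 * C * D * t\<^sup>2"
  proof -
    have 1: "C * t\<^sup>2 / a t * b t * (u * v) = - (u\<^sup>2 * v\<^sup>2 * (b t)\<^sup>2 / D)"
    proof -
      have "C * t\<^sup>2 * b t * (u * v) * D = - (u\<^sup>2 * v\<^sup>2 * (b t)\<^sup>2) * a t" using root by Groebner_Basis.algebra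
      then show ?thesis using nz c by (simp add: field_simps)
    qed
    have 2: "D * t\<^sup>2 / b t * a t * (u * v) = - (u\<^sup>2 * v\<^sup>2 * (a t)\<^sup>2 / C)"
    proof -
      have "D * t\<^sup>2 * a t * (u * v) * C = - (u\<^sup>2 * v\<^sup>2 * (a t)\<^sup>2) * b t" using root by Groebner_Basis.algebra
      then show ?thesis using nz c by (simp add: field_simps)
    qed
    have "t * F' = - (C * t\<^sup>2 / a t * b t * (u * v)) - D * t\<^sup>2 / b t * a t * (u * v) + 2 * C * D * t\<^sup>2"
      by (simp add: F'_def algebra_simps power2_eq_square)
    then show ?thesis unfolding 1 2 by (simp add: algebra_simps)
  qed
  finally show ?thesis .
qed

end

section \<open>Pairings of left and right modes\<close>

lemma complex_nonzero_of_parts: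
  assumes "x * y \<noteq> (0 :: real)"
  shows "complex_of_real x * complex_of_real y - \<i> * complex_of_real c * complex_of_real s \<noteq> 0"
    and "complex_of_real x * complex_of_real y + \<i> * complex_of_real c * complex_of_real s \<noteq> 0"
  using assms by (auto simp: complex_eq_iff)

lemma acoustic_scalar_prod:
  "(k \<cdot>\<^sub>v stack X ((- \<i>) \<cdot>\<^sub>v cvec \<eta>) (- \<beta>)) \<bullet> stack Q ((\<i> * c) \<cdot>\<^sub>v cvec \<eta>) (- w)
     = k * (X * Q + c * complex_of_real (\<eta> \<bullet> \<eta>) + \<beta> * w)"
proof -
  have i2: "\<i> * (c * (\<i> * z)) = - (c * z)" for z
    using mult.left_commute[of "\<i>" c "\<i> * z"] by simp
  show ?thesis by (simp add: scalar_prod_stack cvec_scalar_prod mult.assoc i2)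
qed

text \<open>
  The bracket is \<open>2 C\<^sup>2 N / (C - u\<^sup>2)\<close>: its numerator is quadratic in \<open>a\<close>, and the dispersion relation \<open>a2\<close>
  removes the square.
\<close>

lemma pairing_acoustic:
  fixes u C a t N :: complex
  assumes a2: "a\<^sup>2 = C * ((C - u\<^sup>2) * N - t\<^sup>2)" and nz: "a \<noteq> 0" "C - u\<^sup>2 \<noteq> 0" "u * a + \<i> * C * t \<noteq> 0"
  shows "(C - u\<^sup>2) / (2 * a * (u * a + \<i> * C * t)) *
      ((\<i> * t + 2 * u * ((a + \<i> * u * t) / (C - u\<^sup>2))) * ((u * a - \<i> * C * t) / (C - u\<^sup>2))
        + C * N + (a + \<i> * u * t) / (C - u\<^sup>2) * a)
     = C\<^sup>2 * N / (a * (u * a + \<i> * C * t))"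
proof -
  define k where "k = C - u\<^sup>2"
  define q where "q = u * a + \<i> * C * t"
  have i2: "\<i>\<^sup>2 = -1" by simp
  have "(\<i> * t * k + 2 * u * (a + \<i> * u * t)) * (u * a - \<i> * C * t) + C * N * k\<^sup>2 + (a + \<i> * u * t) * a * k
     = 2 * C\<^sup>2 * N * k"
    unfolding k_def using a2 i2 by Groebner_Basis.algebra
  moreover have "(\<i> * t + 2 * u * ((a + \<i> * u * t) / k)) * ((u * a - \<i> * C * t) / k) + C * N + (a + \<i> * u * t) / k * a
     = ((\<i> * t * k + 2 * u * (a + \<i> * u * t)) * (u * a - \<i> * C * t) + C * N * k\<^sup>2 + (a + \<i> * u * t) * a * k) / k\<^sup>2"
    using nz(2) unfolding k_def[symmetric] by (simp add: field_simps power2_eq_square)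
  ultimately show ?thesis
    using nz unfolding k_def[symmetric] q_def[symmetric] by (simp add: field_simps power2_eq_square)
qed

lemma pairing_shear:
  fixes u C a t N :: complex
  assumes nz: "u \<noteq> 0" "C - u\<^sup>2 \<noteq> 0" "t\<^sup>2 + u\<^sup>2 * N \<noteq> 0" "N \<noteq> 0"
  shows "1 / (t\<^sup>2 + u\<^sup>2 * N) * (u * ((u * a - \<i> * C * t) / (C - u\<^sup>2)) - t / (u * N) * (\<i> * C) * N + a)
     = C * (u * a - \<i> * C * t) / (u * (C - u\<^sup>2) * (t\<^sup>2 + u\<^sup>2 * N))"
proof -
  define L where "L = t\<^sup>2 + u\<^sup>2 * N"
  have "u * ((u * a - \<i> * C * t) / (C - u\<^sup>2)) - t / (u * N) * (\<i> * C) * N + a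
     = C * (u * a - \<i> * C * t) / (u * (C - u\<^sup>2))"
    using nz by (simp add: field_simps) (simp add: power2_eq_square algebra_simps)
  then show ?thesis using nz unfolding L_def[symmetric] by simp
qed

context elliptic_mode
begin

lemma real_nonzero: "u \<noteq> 0" "v \<noteq> 0" "C \<noteq> 0" "D \<noteq> 0" "a t \<noteq> 0" "b t \<noteq> 0" "N \<noteq> 0"
  using speeds_pos(1-6) a_neg b_pos N_pos by (simp_all only: less_imp_neq[symmetric] less_imp_neq not_False_eq_True)

lemma coefficients_nonzero:
  "complex_of_real (a t) \<noteq> 0" "complex_of_real (b t) \<noteq> 0" "complex_of_real C \<noteq> 0" "complex_of_real D \<noteq> 0"
  "complex_of_real u \<noteq> 0" "complex_of_real v \<noteq> 0" "complex_of_real t \<noteq> 0" "complex_of_real N \<noteq> 0"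
  "(complex_of_real t)\<^sup>2 + (complex_of_real u)\<^sup>2 * complex_of_real N \<noteq> 0"
  "(complex_of_real t)\<^sup>2 + (complex_of_real v)\<^sup>2 * complex_of_real N \<noteq> 0"
proof -
  have "complex_of_real (t\<^sup>2 + u\<^sup>2 * N) \<noteq> 0" "complex_of_real (t\<^sup>2 + v\<^sup>2 * N) \<noteq> 0"
    using M_pos by (simp_all only: of_real_eq_0_iff)
  then show "(complex_of_real t)\<^sup>2 + (complex_of_real u)\<^sup>2 * complex_of_real N \<noteq> 0"
    "(complex_of_real t)\<^sup>2 + (complex_of_real v)\<^sup>2 * complex_of_real N \<noteq> 0" by simp_all
qed (simp_all only: of_real_eq_0_iff real_nonzero t not_False_eq_True)

lemma complex_mode_nonzero:
  "complex_of_real u * a t - \<i> * C * t \<noteq> 0" "complex_of_real v * b t - \<i> * D * t \<noteq> 0"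
  "complex_of_real u * a t + \<i> * C * t \<noteq> 0" "complex_of_real v * b t + \<i> * D * t \<noteq> 0"
  "complex_of_real u * b t - \<i> * D * t \<noteq> 0" "complex_of_real v * a t - \<i> * C * t \<noteq> 0"
proof -
  have "u * a t \<noteq> 0" "v * b t \<noteq> 0" "u * b t \<noteq> 0" "v * a t \<noteq> 0" using real_nonzero by simp_all
  note nz = this[THEN complex_nonzero_of_parts(1)] this[THEN complex_nonzero_of_parts(2)]
  show "complex_of_real u * a t - \<i> * C * t \<noteq> 0" "complex_of_real v * b t - \<i> * D * t \<noteq> 0"
    "complex_of_real u * a t + \<i> * C * t \<noteq> 0" "complex_of_real v * b t + \<i> * D * t \<noteq> 0"
    "complex_of_real u * b t - \<i> * D * t \<noteq> 0" "complex_of_real v * a t - \<i> * C * t \<noteq> 0"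
    by (rule nz)+
qed

lemma complex_a_sq: "(complex_of_real (a t))\<^sup>2 = C * ((C - (complex_of_real u)\<^sup>2) * N - (complex_of_real t)\<^sup>2)"
  and complex_b_sq: "(complex_of_real (b t))\<^sup>2 = D * ((D - (complex_of_real v)\<^sup>2) * N - (complex_of_real t)\<^sup>2)"
  using arg_cong[OF a_sq, of complex_of_real] arg_cong[OF b_sq, of complex_of_real] by simp_all

lemma L1_R1:
  "conjugate (L_plus B e' t \<eta> 1) \<bullet> (k \<cdot>\<^sub>v R_minus B e t \<eta> 1) = k * ((complex_of_real C)\<^sup>2 * N / (a t * (u * a t + \<i> * C * t)))"
proof -
  have d: "dim_vec \<eta> = n" using \<eta> by simp
  have "conjugate (l1_plus B t \<eta>) \<bullet> r1_minus B t \<eta> =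
     (C - (complex_of_real u)\<^sup>2) / (2 * a t * (u * a t + \<i> * C * t)) *
      ((\<i> * t + 2 * u * ((a t + \<i> * u * t) / (C - (complex_of_real u)\<^sup>2))) * ((u * a t - \<i> * C * t) / (C - (complex_of_real u)\<^sup>2))
        + C * N + (a t + \<i> * u * t) / (C - (complex_of_real u)\<^sup>2) * a t)"
  proof -
    have "conjugate (l1_plus B t \<eta>) =
      ((C - (complex_of_real u)\<^sup>2) / (2 * a t * (u * a t + \<i> * C * t))) \<cdot>\<^sub>v
        stack (\<i> * t + 2 * u * ((a t + \<i> * u * t) / (C - (complex_of_real u)\<^sup>2))) ((- \<i>) \<cdot>\<^sub>v cvec \<eta>)
          (- ((a t + \<i> * u * t) / (C - (complex_of_real u)\<^sup>2)))"
      unfolding l1_plus_def beta_minus_def conjugate_smult_vec by (simp add: add.commute)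
    then show ?thesis unfolding r1_minus_eq by (simp only: acoustic_scalar_prod of_real_minus of_real_mult of_real_diff of_real_power)
  qed
  also have "\<dots> = (complex_of_real C)\<^sup>2 * N / (a t * (u * a t + \<i> * C * t))"
    using pairing_acoustic[OF complex_a_sq coefficients_nonzero(1) _ complex_mode_nonzero(3)] sonic_nonzero
    by simp
  finally have *: "conjugate (l1_plus B t \<eta>) \<bullet> r1_minus B t \<eta> = (complex_of_real C)\<^sup>2 * N / (a t * (u * a t + \<i> * C * t))" .
  show ?thesis unfolding *[symmetric]
    using d by (simp add: L_plus_def R_minus_def side_scalar_prod l1_plus_def r1_minus_def)
qed

text \<open>
  Up to sign \<open>\<ell>\<^sub>2\<^sup>+\<close> and \<open>r\<^sub>2\<^sup>-\<close> are \<open>\<ell>\<^sub>1\<^sup>+\<close> and \<open>r\<^sub>1\<^sup>-\<close> with the right state in place of the left one.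
\<close>

lemma L2_R2:
  "conjugate (L_plus B e' t \<eta> 2) \<bullet> (k \<cdot>\<^sub>v R_minus B e t \<eta> 2) = k * (- ((complex_of_real D)\<^sup>2 * N / (b t * (v * b t + \<i> * D * t))))"
proof -
  have d: "dim_vec \<eta> = n" using \<eta> by simp
  have "conjugate (l2_plus B t \<eta>) \<bullet> r2_minus B t \<eta> = - (
     (D - (complex_of_real v)\<^sup>2) / (2 * b t * (v * b t + \<i> * D * t)) *
      ((\<i> * t + 2 * v * ((b t + \<i> * v * t) / (D - (complex_of_real v)\<^sup>2))) * ((v * b t - \<i> * D * t) / (D - (complex_of_real v)\<^sup>2))
        + D * N + (b t + \<i> * v * t) / (D - (complex_of_real v)\<^sup>2) * b t))"
  proof -
    have "conjugate (l2_plus B t \<eta>) =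
      (- ((D - (complex_of_real v)\<^sup>2) / (2 * b t * (v * b t + \<i> * D * t)))) \<cdot>\<^sub>v
        stack (\<i> * t + 2 * v * ((b t + \<i> * v * t) / (D - (complex_of_real v)\<^sup>2))) ((- \<i>) \<cdot>\<^sub>v cvec \<eta>)
          (- ((b t + \<i> * v * t) / (D - (complex_of_real v)\<^sup>2)))"
    proof -
      have \<beta>: "cnj (beta_minus B t \<eta> 2) = - ((b t + \<i> * v * t) / (D - (complex_of_real v)\<^sup>2))"
        using sonic_nonzero(2) by (simp add: beta_minus_def field_simps)
      have "conjugate (l2_plus B t \<eta>) = ((D - (complex_of_real v)\<^sup>2) / (2 * b t * (v * b t + \<i> * D * t))) \<cdot>\<^sub>v
        stack (- \<i> * t + 2 * v * cnj (beta_minus B t \<eta> 2)) (\<i> \<cdot>\<^sub>v cvec \<eta>) (- cnj (beta_minus B t \<eta> 2))"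
        unfolding l2_plus_def conjugate_smult_vec by simp
      also have "\<dots> = (- ((D - (complex_of_real v)\<^sup>2) / (2 * b t * (v * b t + \<i> * D * t)))) \<cdot>\<^sub>v
        stack (\<i> * t - 2 * v * cnj (beta_minus B t \<eta> 2)) ((- \<i>) \<cdot>\<^sub>v cvec \<eta>) (cnj (beta_minus B t \<eta> 2))"
        by (subst smult_stack_minus) simp
      finally show ?thesis unfolding \<beta> by simp
    qed
    then show ?thesis unfolding r2_minus_eq by (simp only: acoustic_scalar_prod of_real_minus of_real_mult of_real_diff of_real_power mult_minus_left)
  qed
  also have "\<dots> = - ((complex_of_real D)\<^sup>2 * N / (b t * (v * b t + \<i> * D * t)))"
    using pairing_acoustic[OF complex_b_sq coefficients_nonzero(2) _ complex_mode_nonzero(4)] sonic_nonzero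
    by simp
  finally have *: "conjugate (l2_plus B t \<eta>) \<bullet> r2_minus B t \<eta> = - ((complex_of_real D)\<^sup>2 * N / (b t * (v * b t + \<i> * D * t)))" .
  show ?thesis unfolding *[symmetric]
    using d by (simp add: L_plus_def R_minus_def side_scalar_prod l2_plus_def r2_minus_def)
qed

lemma L3_R1:
  "conjugate (L_plus B e' t \<eta> 3) \<bullet> (k \<cdot>\<^sub>v R_minus B e t \<eta> 1) = k * (C * (u * a t - \<i> * C * t) /
      (u * (C - (complex_of_real u)\<^sup>2) * ((complex_of_real t)\<^sup>2 + (complex_of_real u)\<^sup>2 * N)))"
proof -
  have d: "dim_vec \<eta> = n" using \<eta> by simp
  have l3: "conjugate (l3_plus B t \<eta>) = (1 / ((complex_of_real t)\<^sup>2 + (complex_of_real u)\<^sup>2 * N)) \<cdot>\<^sub>v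
      stack (complex_of_real u) ((- (t / (complex_of_real u * N))) \<cdot>\<^sub>v cvec \<eta>) (- 1)"
    unfolding l3_plus_def by (rule eq_vecI) (auto simp: stack_def)
  have "conjugate (l3_plus B t \<eta>) \<bullet> r1_minus B t \<eta> =
     1 / ((complex_of_real t)\<^sup>2 + (complex_of_real u)\<^sup>2 * N) *
       (u * ((u * a t - \<i> * C * t) / (C - (complex_of_real u)\<^sup>2)) - t / (complex_of_real u * N) * (\<i> * C) * N + a t)"
    unfolding r1_minus_eq l3
    by (simp add: scalar_prod_stack cvec_scalar_prod d)
  also have "\<dots> = C * (u * a t - \<i> * C * t) /
      (u * (C - (complex_of_real u)\<^sup>2) * ((complex_of_real t)\<^sup>2 + (complex_of_real u)\<^sup>2 * N))"
    unfolding of_real_mult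
    by (intro pairing_shear sonic_nonzero coefficients_nonzero)
  finally have *: "conjugate (l3_plus B t \<eta>) \<bullet> r1_minus B t \<eta> = C * (u * a t - \<i> * C * t) /
      (u * (C - (complex_of_real u)\<^sup>2) * ((complex_of_real t)\<^sup>2 + (complex_of_real u)\<^sup>2 * N))" .
  show ?thesis unfolding *[symmetric]
    using d by (simp add: L_plus_def R_minus_def side_scalar_prod l3_plus_def r1_minus_def)
qed

text \<open>
  Either the two modes live on opposite sides of the boundary, or \<open>p \<ge> 4\<close> and \<open>q = 1\<close>, where the pairing is a multiple
  of \<open>e' (p - 2) \<bullet> \<eta> = 0\<close>.
\<close>

lemma L_R_zero:
  assumes p: "p \<in> {1..n + 2}" and q: "q \<in> {1, 2}" and pq: "(p, q) \<notin> {(1, 1), (2, 2), (3, 1)}"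
  shows "conjugate (L_plus B e' t \<eta> p) \<bullet> (k \<cdot>\<^sub>v R_minus B e t \<eta> q) = 0"
proof -
  have d: "dim_vec \<eta> = n" using \<eta> by simp
  have dims: "dim_vec (l1_plus B t \<eta>) = n + 2" "dim_vec (l2_plus B t \<eta>) = n + 2" "dim_vec (l3_plus B t \<eta>) = n + 2"
    "dim_vec (r1_minus B t \<eta>) = n + 2" "dim_vec (r2_minus B t \<eta>) = n + 2"
    by (simp_all add: l1_plus_def l2_plus_def l3_plus_def r1_minus_def r2_minus_def d)
  have j: "dim_vec (lj_plus B e' t p) = n + 2" "conjugate (lj_plus B e' t p) \<bullet> r1_minus B t \<eta> = 0" if "p \<ge> 4"
  proof -
    have k: "2 \<le> p - 2" "p - 2 \<le> n" using that p by auto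
    have d': "dim_vec (e' (p - 2)) = n" using e'_carrier[OF k] by simp
    then show "dim_vec (lj_plus B e' t p) = n + 2" by (simp add: lj_plus_def)
    have lj: "conjugate (lj_plus B e' t p) = complex_of_real (- 1 / (u * t)) \<cdot>\<^sub>v stack 0 (cvec (e' (p - 2))) 0"
      unfolding lj_plus_def by (rule eq_vecI) (auto simp: stack_def)
    show "conjugate (lj_plus B e' t p) \<bullet> r1_minus B t \<eta> = 0"
      unfolding lj r1_minus_eq
      by (simp add: scalar_prod_stack cvec_scalar_prod d d' e'_orth[OF k])
  qed
  consider "p = 1" | "p = 2" | "p = 3" | "p \<ge> 4" using p by fastforce
  then show ?thesis
    by cases (use pq q dims j in \<open>auto simp: L_plus_def R_minus_def side_scalar_prod\<close>)
qed

lemma dim_L_plus: "p \<in> {1..n + 2} \<Longrightarrow> dim_vec (L_plus B e' t \<eta> p) = (n + 2) + (n + 2)"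
  using e'_carrier[of "p - 2"] \<eta>
  by (auto simp: L_plus_def on_left_def on_right_def l1_plus_def l2_plus_def l3_plus_def lj_plus_def dm_eq)

lemma dim_R_minus: "q \<in> {1..n + 2} \<Longrightarrow> dim_vec (R_minus B e t \<eta> q) = (n + 2) + (n + 2)"
  using e[of "q - 2"] \<eta>
  by (auto simp: R_minus_def on_left_def on_right_def r1_minus_def r2_minus_def rj_minus_def dm_eq)

lemma beta_differences:
  "beta_plus B t \<eta> 1 - beta_minus B t \<eta> 1 = - (2 * a t / (C - (complex_of_real u)\<^sup>2))"
  "beta_plus B t \<eta> 2 - beta_minus B t \<eta> 2 = 2 * b t / (D - (complex_of_real v)\<^sup>2)"
  "beta_plus B t \<eta> 3 - beta_minus B t \<eta> 1 = - ((u * a t - \<i> * C * t) / (u * (C - (complex_of_real u)\<^sup>2)))"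
proof -
  define k where "k = C - (complex_of_real u)\<^sup>2"
  define m where "m = D - (complex_of_real v)\<^sup>2"
  have k: "k \<noteq> 0" "m \<noteq> 0" using sonic_nonzero by (simp_all add: k_def m_def)
  have \<beta>: "beta_minus B t \<eta> 1 = (a t - \<i> * u * t) / k" "beta_plus B t \<eta> 1 = - ((a t + \<i> * u * t) / k)"
    "beta_minus B t \<eta> 2 = (- b t + \<i> * v * t) / m" "beta_plus B t \<eta> 2 = - ((- b t - \<i> * v * t) / m)"
    "beta_plus B t \<eta> 3 = \<i> * t / u"
    by (simp_all add: beta_plus_def beta_minus_def k_def m_def)
  have "\<i> * t * k = \<i> * t * C - \<i> * t * u * u" by (simp add: k_def algebra_simps power2_eq_square)
  then have "\<i> * t / complex_of_real u - (a t - \<i> * u * t) / k = - ((u * a t - \<i> * C * t) / (u * k))"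
    using k coefficients_nonzero(5) by (simp add: field_simps del: of_real_power)
  then show "beta_plus B t \<eta> 3 - beta_minus B t \<eta> 1 = - ((u * a t - \<i> * C * t) / (u * (C - (complex_of_real u)\<^sup>2)))"
    unfolding \<beta> k_def .
  show "beta_plus B t \<eta> 1 - beta_minus B t \<eta> 1 = - (2 * a t / (C - (complex_of_real u)\<^sup>2))"
    "beta_plus B t \<eta> 2 - beta_minus B t \<eta> 2 = 2 * b t / (D - (complex_of_real v)\<^sup>2)"
    unfolding \<beta> k_def[symmetric] m_def[symmetric] using k by (simp_all add: field_simps)
qed

end

section \<open>Evaluation at a root\<close>

context elliptic_mode
begin

lemma alpha0_eq:
  assumes root: "u * v * a t * b t + C * D * t\<^sup>2 = 0" and \<sigma>: "is_sigma B e t \<eta> \<sigma>"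
  shows "alpha0 B e e' t \<eta> \<sigma> = complex_of_real
      (- (R * (v - u) * Upsilon B e t / t) * (t\<^sup>2 + v\<^sup>2 * N)
        * (u\<^sup>2 * v\<^sup>2 * ((a t)\<^sup>2 / C + (b t)\<^sup>2 / D) + 2 * C * D * t\<^sup>2))"
proof -
  define \<Lambda> where "\<Lambda> = lopatinskii_functional u v C D (a t) (b t) t N \<mu>"
  define g1 where "g1 = gamma B t \<eta> 1"
  define g2 where "g2 = gamma B t \<eta> 2"
  have form: "conjugate \<sigma> \<bullet> balance x0 (y \<cdot>\<^sub>v cvec \<eta>) x1 z = - complex_of_real (Upsilon B e t) * \<Lambda> x0 y x1 z" for x0 y x1 z
  proof -
    have "balance x0 (y \<cdot>\<^sub>v cvec \<eta>) x1 z \<in> carrier_vec (dm B + 2)"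
      using \<eta> by (intro carrier_vecI) (simp add: dm_eq)
    then have "conjugate \<sigma> \<bullet> balance x0 (y \<cdot>\<^sub>v cvec \<eta>) x1 z
        = lopatinskii_det B e t \<eta> (balance x0 (y \<cdot>\<^sub>v cvec \<eta>) x1 z)"
      using \<sigma> unfolding is_sigma_def by (metis (no_types))
    then show ?thesis by (simp only: lopatinskii_det_eq[OF t] \<Lambda>_def)
  qed
  define f where "f = (\<lambda>p q. (conjugate \<sigma> \<bullet> (cmat (H_mat B) *\<^sub>v R_plus B e t \<eta> p))
          * (conjugate (L_plus B e' t \<eta> p) \<bullet> (gamma B t \<eta> q \<cdot>\<^sub>v R_minus B e t \<eta> q))
          / (beta_plus B t \<eta> p - beta_minus B t \<eta> q))"
  have L_zero: "conjugate (L_plus B e' t \<eta> p) \<bullet> (gamma B t \<eta> q \<cdot>\<^sub>v R_minus B e t \<eta> q) = 0"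
    if "p \<in> {1..n + 2}" "q \<in> {1..n + 2}" "(p, q) \<notin> {(1, 1), (2, 2), (3, 1)}" for p q
  proof (cases "q \<in> {1, 2}")
    case True
    then show ?thesis using L_R_zero that by blast
  next
    case False
    then have "gamma B t \<eta> q = 0" by (simp add: gamma_def)
    moreover have "dim_vec (L_plus B e' t \<eta> p) = dim_vec (R_minus B e t \<eta> q)"
      using that dim_L_plus dim_R_minus by simp
    ultimately show ?thesis by simp
  qed
  have "(\<Sum>p=1..dm B + 1. \<Sum>q=1..dm B + 1. f p q) = (\<Sum>pq\<in>{1..n + 2} \<times> {1..n + 2}. f (fst pq) (snd pq))"
  proof -
    have d: "dm B + 1 = n + 2" by (simp add: dm_eq)
    show ?thesis unfolding d sum.cartesian_product case_prod_unfold ..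
  qed
  also have "\<dots> = (\<Sum>pq\<in>{(1, 1), (2, 2), (3, 1)}. f (fst pq) (snd pq))"
  proof (rule sum.mono_neutral_right)
    show "{(1, 1), (2, 2), (3, 1)} \<subseteq> {1..n + 2} \<times> {1..n + 2}" using n_pos by auto
    show "\<forall>pq \<in> {1..n + 2} \<times> {1..n + 2} - {(1, 1), (2, 2), (3, 1)}. f (fst pq) (snd pq) = 0"
    proof
      fix pq assume "pq \<in> {1..n + 2} \<times> {1..n + 2} - {(1, 1), (2, 2), (3, 1)}"
      then show "f (fst pq) (snd pq) = 0"
        using L_zero[of "fst pq" "snd pq"] by (simp only: f_def) (cases pq; simp)
    qed
  qed simp
  also have "\<dots> = f 1 1 + f 2 2 + f 3 1" by simp
  finally have sum: "(\<Sum>p=1..dm B + 1. \<Sum>q=1..dm B + 1. f p q) = f 1 1 + f 2 2 + f 3 1" .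
  let ?u = "complex_of_real u" let ?v = "complex_of_real v" let ?C = "complex_of_real C" let ?D = "complex_of_real D"
  let ?a = "complex_of_real (a t)" let ?b = "complex_of_real (b t)" let ?t = "complex_of_real t"
  let ?N = "complex_of_real N" let ?R = "complex_of_real R" let ?\<mu> = "complex_of_real \<mu>"
  let ?\<Upsilon> = "complex_of_real (Upsilon B e t)"
  define S0 where "S0 = \<Lambda> ?R 0 0 (?\<mu> * ?R - ?u * ?v * ?R)"
  define S1 where "S1 = \<Lambda> (- ?a) (- \<i> * ?u * ?C) (- ?u * ?a + \<i> * ?C * ?t) (\<i> * ?u * ?C * ?t - ?\<mu> * ?a)"
  define S2 where "S2 = \<Lambda> ?b (\<i> * ?v * ?D) (?v * ?b - \<i> * ?D * ?t) (?\<mu> * ?b - \<i> * ?v * ?D * ?t)"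
  define S3 where "S3 = \<Lambda> (?u * ?N) (?u * ?t) (2 * ?u\<^sup>2 * ?N) ((?u\<^sup>2 + ?\<mu>) * ?u * ?N)"
  have root': "?u * ?v * ?a * ?b + ?C * ?D * ?t\<^sup>2 = 0"
    using arg_cong[OF root, of complex_of_real] by simp
  have f: "f 1 1 = - ?\<Upsilon> * (S1 * (g1 * (?C\<^sup>2 * ?N / (?a * (?u * ?a + \<i> * ?C * ?t)))) / (- (2 * ?a / (?C - ?u\<^sup>2))))"
    "f 2 2 = - ?\<Upsilon> * (S2 * (g2 * (- (?D\<^sup>2 * ?N / (?b * (?v * ?b + \<i> * ?D * ?t))))) / (2 * ?b / (?D - ?v\<^sup>2)))"
    "f 3 1 = - ?\<Upsilon> * (S3 * (g1 * (?C * (?u * ?a - \<i> * ?C * ?t) / (?u * (?C - ?u\<^sup>2) * (?t\<^sup>2 + ?u\<^sup>2 * ?N))))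
            / (- ((?u * ?a - \<i> * ?C * ?t) / (?u * (?C - ?u\<^sup>2)))))"
    unfolding f_def H_R1_plus H_R2_plus H_R3_plus form L1_R1 L2_R2 L3_R1 beta_differences
      S1_def S2_def S3_def g1_def g2_def
    by (simp_all only: mult.assoc times_divide_eq_right of_real_mult of_real_add of_real_minus of_real_numeral of_real_power)
  have "alpha0 B e e' t \<eta> \<sigma> = conjugate \<sigma> \<bullet> cvec (jump_flux B 0)
      + \<i> * (\<Sum>p=1..dm B + 1. \<Sum>q=1..dm B + 1. f p q)"
    unfolding alpha0_def f_def ..
  then have \<alpha>: "alpha0 B e e' t \<eta> \<sigma> = - ?\<Upsilon> * S0 + \<i> * (f 1 1 + f 2 2 + f 3 1)"
    unfolding sum cvec_jump_flux_time form S0_def of_real_mult of_real_diff .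
  have factor: "- ?\<Upsilon> * S0 + \<i> * (- ?\<Upsilon> * x1 + - ?\<Upsilon> * x2 + - ?\<Upsilon> * x3)
      = - ?\<Upsilon> * (S0 + \<i> * (x1 + x2 + x3))" for x1 x2 x3
    unfolding distrib_left by (simp only: mult.left_commute add.assoc)
  have S: "?t * S0 = - ?R * (?v - ?u) * ?v\<^sup>2 * ?N * (?u * ?b - \<i> * ?D * ?t) * (?u * ?a - \<i> * ?C * ?t)"
    "S1 = - 2 * \<i> * ?a * (?v - ?u) * (?t\<^sup>2 + ?v\<^sup>2 * ?N) * ?C * (?u * ?b - \<i> * ?D * ?t)"
    "S2 = 2 * \<i> * ?b * (?v - ?u) * (?t\<^sup>2 + ?v\<^sup>2 * ?N) * ?D * (?v * ?a - \<i> * ?C * ?t)"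
    "?t * S3 = - (?v - ?u) * ?N * (?u * ?b - \<i> * ?D * ?t) * (?u * ?a - \<i> * ?C * ?t)
         * (?u * (?t\<^sup>2 + ?v\<^sup>2 * ?N) - ?v * (?t\<^sup>2 + ?u\<^sup>2 * ?N))"
    unfolding S0_def S1_def S2_def S3_def \<Lambda>_def
    by (rule lopatinskii_functional_time_jump[OF root'] lopatinskii_functional_R1_plus lopatinskii_functional_R2_plus lopatinskii_functional_R3_plus[OF root'])+
  have g: "g1 = ?R * ?v * ?t / (?v * ?a - \<i> * ?C * ?t)" "g2 = - ?R * ?u * ?t / (?u * ?b - \<i> * ?D * ?t)"
    by (simp_all add: g1_def g2_def gamma_def)
  note nz = coefficients_nonzero complex_mode_nonzero[unfolded of_real_mult] sonic_nonzero
  have "alpha0 B e e' t \<eta> \<sigma> = - ?\<Upsilon> * (?R * (?v - ?u) * (?t\<^sup>2 + ?v\<^sup>2 * ?N) / ?t *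
      (?u\<^sup>2 * ?v\<^sup>2 * (?a\<^sup>2 / ?C + ?b\<^sup>2 / ?D) + 2 * ?C * ?D * ?t\<^sup>2))"
    unfolding \<alpha> f factor
    by (subst mode_sum_at_root[OF root' complex_a_sq complex_b_sq _ _ _ _ _ _ _ _ _ _ _ _ _ _ _ _ _ g S]) (rule nz refl)+
  also have "\<dots> = complex_of_real (- (R * (v - u) * Upsilon B e t / t) * (t\<^sup>2 + v\<^sup>2 * N)
        * (u\<^sup>2 * v\<^sup>2 * ((a t)\<^sup>2 / C + (b t)\<^sup>2 / D) + 2 * C * D * t\<^sup>2))"
    by simp
  finally show ?thesis .
qed

end

theorem proposition1:
  fixes B :: phase_boundary
    and \<eta>\<^sub>0 :: real and \<eta> :: "real vec"
    and e e' :: "nat \<Rightarrow> real vec"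
    and \<sigma> :: "complex vec"
  assumes "reference_phase_boundary B"
    and "elliptic_frequency B \<eta>\<^sub>0 \<eta>"
    and "transverse_bases B \<eta> e e'"
    and "Delta B e \<eta>\<^sub>0 \<eta> = 0"
    and "is_sigma B e \<eta>\<^sub>0 \<eta> \<sigma>"
  shows "alpha0 B e e' \<eta>\<^sub>0 \<eta> \<sigma> =
           complex_of_real
             (- ((rho_r B - rho_l B) * (u_r B - u_l B) * Upsilon B e \<eta>\<^sub>0 / \<eta>\<^sub>0)
              * (\<eta>\<^sub>0\<^sup>2 + (u_r B)\<^sup>2 * (\<eta> \<bullet> \<eta>))
              * ((u_l B)\<^sup>2 * (u_r B)\<^sup>2
                   * ((a_l B \<eta>\<^sub>0 \<eta>)\<^sup>2 / (c_l B)\<^sup>2 + (a_r B \<eta>\<^sub>0 \<eta>)\<^sup>2 / (c_r B)\<^sup>2)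
                 + 2 * (c_l B)\<^sup>2 * (c_r B)\<^sup>2 * \<eta>\<^sub>0\<^sup>2)) \<and>
         ((\<lambda>t. Delta B e t \<eta>) has_vector_derivative alpha0 B e e' \<eta>\<^sub>0 \<eta> \<sigma>) (at \<eta>\<^sub>0) \<and>
         alpha0 B e e' \<eta>\<^sub>0 \<eta> \<sigma> \<in> \<real> \<and>
         alpha0 B e e' \<eta>\<^sub>0 \<eta> \<sigma> \<noteq> 0"
proof -
  define n where "n = dm B - 1"
  have dm: "dm B = n + 1" using assms(1) by (simp add: reference_phase_boundary_def n_def)
  define W where "W = orth_compl n \<eta>"
  have \<eta>: "\<eta> \<in> carrier_vec n" "\<eta> \<noteq> 0\<^sub>v n" using assms(2) by (simp_all add: elliptic_frequency_def n_def)
  have basis: "e 1 = \<eta>" "vectorspace.basis class_ring (module_vec TYPE(real) n\<lparr>carrier := W\<rparr>) (e ` {2..n})"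
    "\<And>k. k \<in> {2..n} \<Longrightarrow> e' k \<in> W"
    "\<And>k l. k \<in> {2..n} \<Longrightarrow> l \<in> {2..n} \<Longrightarrow> e' k \<bullet> e l = (if k = l then 1 else 0)"
    using assms(3) unfolding transverse_bases_def Let_def n_def[symmetric] W_def[symmetric] by blast+
  \<comment> \<open>The meaning of \<open>basis\<close> is only available relative to a vector space, so the orthogonal complement of
    \<open>\<eta>\<close> must first be recognised as one.\<close>
  have eW: "e k \<in> W" if "k \<in> {2..n}" for k
  proof -
    have V: "vectorspace class_ring (module_vec TYPE(real) n)" by (rule vec_vs)
    then have M: "module class_ring (module_vec TYPE(real) n)" by (rule vectorspace.axioms(1))
    have "submodule class_ring W (module_vec TYPE(real) n)"
      unfolding submodule_def using M \<eta>
      by (auto simp: module_vec_simps W_def orth_compl_def class_ring_simps add_scalar_prod_distrib[of _ n])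
    then have "vectorspace class_ring (module_vec TYPE(real) n\<lparr>carrier := W\<rparr>)"
      using V vectorspace.subspace_is_vs VectorSpace.subspace.intro by blast
    from vectorspace.basis_def[OF this] basis(2) that show ?thesis by auto
  qed
  have W: "x \<in> carrier_vec n \<and> x \<bullet> \<eta> = 0" if "x \<in> W" for x
    using that by (simp add: W_def orth_compl_def)
  have N: "0 < \<eta> \<bullet> \<eta>"
  proof -
    obtain i where i: "i < n" "\<eta> $ i \<noteq> 0" using \<eta> by (metis carrier_vecD eq_vecI index_zero_vec)
    have "0 < (\<Sum>i = 0..<n. \<eta> $ i * \<eta> $ i)"
      by (rule sum_pos2[of _ i]) (use i in \<open>auto simp: zero_less_mult_iff linorder_neq_iff\<close>)
    then show ?thesis using \<eta> by (simp add: scalar_prod_def)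
  qed
  interpret elliptic_mode B n \<eta> e \<eta>\<^sub>0 e'
  proof unfold_locales
    fix k assume "1 \<le> k" "k \<le> n"
    then show "e k \<in> carrier_vec n" using eW[of k] W basis(1) \<eta> by (cases "k = 1") auto
  qed (use assms(1,2) dm \<eta> N basis eW W in \<open>auto simp: elliptic_frequency_def\<close>)
  have root: "u * v * a \<eta>\<^sub>0 * b \<eta>\<^sub>0 + C * D * \<eta>\<^sub>0\<^sup>2 = 0" using assms(4) root_iff by simp
  note \<alpha> = alpha0_eq[OF root assms(5)]
  have "u\<^sup>2 * v\<^sup>2 * ((a \<eta>\<^sub>0)\<^sup>2 / C + (b \<eta>\<^sub>0)\<^sup>2 / D) + 2 * C * D * \<eta>\<^sub>0\<^sup>2 \<noteq> 0"
  proof -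
    have "0 < 2 * C * D * \<eta>\<^sub>0\<^sup>2" using speeds_pos t by simp
    moreover have "0 \<le> u\<^sup>2 * v\<^sup>2 * ((a \<eta>\<^sub>0)\<^sup>2 / C + (b \<eta>\<^sub>0)\<^sup>2 / D)" by simp
    ultimately show ?thesis by linarith
  qed
  then have "- (R * (v - u) * Upsilon B e \<eta>\<^sub>0 / \<eta>\<^sub>0) * (\<eta>\<^sub>0\<^sup>2 + v\<^sup>2 * N)
        * (u\<^sup>2 * v\<^sup>2 * ((a \<eta>\<^sub>0)\<^sup>2 / C + (b \<eta>\<^sub>0)\<^sup>2 / D) + 2 * C * D * \<eta>\<^sub>0\<^sup>2) \<noteq> 0"
    using jumps_nonzero Upsilon_nonzero t M_pos(2) by simp
  then have "alpha0 B e e' \<eta>\<^sub>0 \<eta> \<sigma> \<noteq> 0" unfolding \<alpha> of_real_eq_0_iff .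
  moreover have "alpha0 B e e' \<eta>\<^sub>0 \<eta> \<sigma> \<in> \<real>" unfolding \<alpha> by (rule Reals_of_real)
  ultimately show ?thesis using \<alpha> Delta_derivative[OF root] by simp
qed

end
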